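(* Let $(M,\nabla,P,g)$ be a para-K\"ahler-like statistical manifold and let $(M',P',g')$ be an almost para-Hermitian-like manifold endowed with a statistical structure $(\nabla',g')$. If $\pi:M\to M'$ is a para-K\"ahler-like statistical submersion, then: (i) $T_{\widehat PU}\widehat PV=T_UV$ for all $U,V\in\Gamma(\mathcal V)$; (ii) $A_XY=A^*_XY=0$ for all $X,Y\in\Gamma(\mathcal H)$, provided that $\mathrm{rank}(\widehat P+\widehat P^* )$ coincides with the dimension of the fibers.
   Context: Let $(M,g)$ be a semi-Riemannian manifold ($g$ nondegenerate of arbitrary constant index). A pair $(\nabla,g)$, with $\nabla$ an affine connection, is a statistical structure on $M$ if $\nabla$ is torsion-free and $\nabla g$ is symmetric, i.e. $(\nabla_E g)(F,G)=(\nabla_F g)(E,G)$; then $(M,\nabla,g)$ is a statistical manifold. The conjugate connection $\nabla^*$ of $\nabla$ is defined by $Eg(F,G)=g(\nabla_EF,G)+g(F,\nabla^*_EG)$ for all vector fields $E,F,G$. An almost product structure on $M$ is a tensor field $P$ of type $(1,1)$ with $P\neq\pm\mathrm{Id}$ and $P^2=\mathrm{Id}$. If $P$ is an almost product structure on a semi-Riemannian manifold $(M,g)$, then $(M,P,g)$ is called an almost para-Hermitian-like manifold (no compatibility between $P$ and $g$ is required), and $P^*$ denotes the $(1,1)$ tensor field with $g(PE,F)+g(E,P^*F)=0$ for all vector fields $E,F$. If in addition $(\nabla,g)$ is a statistical structure on $M$ with $\nabla P=0$, then $(M,\nabla,P,g)$ is called a para-K\"ahler-like statistical manifold. A semi-Riemannian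 submersion is a smooth surjective map $\pi:M\to M'$ between connected semi-Riemannian manifolds $(M,g)$, $(M',g')$ (of indices $s$, $s'$ with $s'\le s$) such that each $\pi_{*|p}$ is onto, the fibers $\pi^{-1}(p')$ are semi-Riemannian submanifolds of $M$, and $\pi_*$ preserves scalar products of vectors normal to fibers. Vectors tangent to fibers are vertical (distribution $\mathcal V$, projection $v$); vectors normal to fibers are horizontal (distribution $\mathcal H$, projection $h$). A horizontal vector field $X$ on $M$ is basic if it is $\pi$-related to a vector field $X'$ on $M'$. A semi-Riemannian submersion $\pi$ between statistical manifolds $(M,\nabla,g)$ and $(M',\nabla',g')$ is a statistical submersion if $\pi_*(\nabla_XY)_p=(\nabla'_{X'}Y')_{\pi(p)}$ for all $p\in M$ and all basic vector fields $X,Y$ on $M$ that are $\pi$-related to $X',Y'$ on $M'$. It is an almost para-Hermitian-like statistical submersion (for almost product structures $P$ on $M$ and $P'$ on $M'$) if moreover $\pi_*\circ P=P'\circ\pi_*$. If in addition $(M,\nabla,P,g)$ is a para-K\"ahler-like statistical manifold, then $\pi$ is called a para-K\"ahler-like statistical submersion. For vector fields $E,F$ on $M$ set $T_EF=h\nabla_{vE}vF+v\nabla_{vE}hF$ and $A_EF=v\nabla_{hE}hF+h\nabla_{hE}vF$; $A^*$ is defined in the same way with $\nabla^*$ in place of $\nabla$. For such a submersion $P$ and $P^*$ preserve $\mathcal V$, and $\widehat P$, $\widehat P^*$ denote their restrictions to the fibers (i.e. to $\mathcal V$); the rank condition is meant at every point.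
   Formalization: In (ii) it is assumed explicitly that P* preserves the vertical distribution; this does not follow from the other hypotheses, and without it the restriction of P* to the fibers is undefined (with its vertical part instead, (ii) is false). *)

theory Defs
  imports "HOL-Analysis.Analysis" "HOL-Library.Function_Algebras"
begin

section \<open>Smooth manifolds, tangent vectors and vector fields\<close>

text \<open>Tangent vectors are functionals on functions, so functions need their pointwise
  real vector space structure.\<close>

instantiation "fun" :: (type, real_vector) real_vector
begin

definition scaleR_fun :: "real \<Rightarrow> ('a \<Rightarrow> 'b) \<Rightarrow> 'a \<Rightarrow> 'b" where
  "scaleR_fun c f = (\<lambda>x. c *\<^sub>R f x)"

instance
  by standard (simp_all add: scaleR_fun_def fun_eq_iff scaleR_add_right scaleR_add_left)

end

text \<open>Class \<open>C\<^sup>k\<close> on an open set \<open>S\<close>, through all iterated directional derivatives.\<close>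

primrec Ck_on :: "nat \<Rightarrow> 'a::euclidean_space set \<Rightarrow> ('a \<Rightarrow> 'b::real_normed_vector) \<Rightarrow> bool" where
  "Ck_on 0 S f \<longleftrightarrow> continuous_on S f"
| "Ck_on (Suc k) S f \<longleftrightarrow>
     (\<forall>x\<in>S. f differentiable (at x)) \<and> (\<forall>v. Ck_on k S (\<lambda>x. frechet_derivative f (at x) v))"

definition smooth_on :: "'a::euclidean_space set \<Rightarrow> ('a \<Rightarrow> 'b::real_normed_vector) \<Rightarrow> bool" where
  "smooth_on S f \<longleftrightarrow> (\<forall>k. Ck_on k S f)"

type_synonym ('m, 'e) atlas = "('m set \<times> ('m \<Rightarrow> 'e)) set"

text \<open>A smooth manifold is a Hausdorff, second countable type with a smooth atlas. The atlas
  need not be maximal.\<close>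

definition smooth_manifold ::
  "('m::{t2_space,second_countable_topology}, 'e::euclidean_space) atlas \<Rightarrow> bool" where
  "smooth_manifold A \<longleftrightarrow>
     (\<Union>(U, \<phi>)\<in>A. U) = UNIV \<and>
     (\<forall>(U, \<phi>)\<in>A. open U \<and> open (\<phi> ` U) \<and> (\<exists>\<psi>. homeomorphism U (\<phi> ` U) \<phi> \<psi>)) \<and>
     (\<forall>(U, \<phi>)\<in>A. \<forall>(V, \<psi>)\<in>A. smooth_on (\<phi> ` (U \<inter> V)) (\<psi> \<circ> inv_into U \<phi>))"

definition smooth_fun :: "('m, 'e::euclidean_space) atlas \<Rightarrow> ('m \<Rightarrow> real) \<Rightarrow> bool" where
  "smooth_fun A f \<longleftrightarrow> (\<forall>(U, \<phi>)\<in>A. smooth_on (\<phi> ` U) (f \<circ> inv_into U \<phi>))"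

definition smooth_map ::
  "('m::topological_space, 'e::euclidean_space) atlas \<Rightarrow>
   ('n::topological_space, 'f::euclidean_space) atlas \<Rightarrow> ('m \<Rightarrow> 'n) \<Rightarrow> bool" where
  "smooth_map A A' \<pi> \<longleftrightarrow> continuous_on UNIV \<pi> \<and>
     (\<forall>(U, \<phi>)\<in>A. \<forall>(V, \<psi>)\<in>A'. smooth_on (\<phi> ` (U \<inter> \<pi> -` V)) (\<psi> \<circ> \<pi> \<circ> inv_into U \<phi>))"

type_synonym 'm tvec = "('m \<Rightarrow> real) \<Rightarrow> real"
type_synonym 'm vfield = "'m \<Rightarrow> 'm tvec"
type_synonym 'm connection = "'m vfield \<Rightarrow> 'm vfield \<Rightarrow> 'm vfield"
type_synonym 'm tensor11 = "'m \<Rightarrow> 'm tvec \<Rightarrow> 'm tvec"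
type_synonym 'm tensor02 = "'m \<Rightarrow> 'm tvec \<Rightarrow> 'm tvec \<Rightarrow> real"

text \<open>Tangent vectors at \<open>p\<close> are the directional derivatives at \<open>p\<close>, taken in charts, acting on
  smooth functions. They are given the value 0 on non-smooth functions, so that equality of
  tangent vectors is equality of functionals.\<close>

definition tangent_space :: "('m, 'e::euclidean_space) atlas \<Rightarrow> 'm \<Rightarrow> 'm tvec set" where
  "tangent_space A p = {D. \<exists>(U, \<phi>)\<in>A. p \<in> U \<and>
     (\<exists>v. D = (\<lambda>f. if smooth_fun A f
                    then frechet_derivative (f \<circ> inv_into U \<phi>) (at (\<phi> p)) v else 0))}"

definition pushforward :: "('n, 'f::euclidean_space) atlas \<Rightarrow> ('m \<Rightarrow> 'n) \<Rightarrow> 'm tvec \<Rightarrow> 'n tvec" where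
  "pushforward A' \<pi> D = (\<lambda>f. if smooth_fun A' f then D (f \<circ> \<pi>) else 0)"

definition vector_field :: "('m, 'e::euclidean_space) atlas \<Rightarrow> 'm vfield \<Rightarrow> bool" where
  "vector_field A X \<longleftrightarrow> (\<forall>p. X p \<in> tangent_space A p) \<and>
     (\<forall>f. smooth_fun A f \<longrightarrow> smooth_fun A (\<lambda>p. X p f))"

definition lie_bracket :: "'m vfield \<Rightarrow> 'm vfield \<Rightarrow> 'm vfield" where
  "lie_bracket X Y = (\<lambda>p f. X p (\<lambda>q. Y q f) - Y p (\<lambda>q. X q f))"

section \<open>Tensor fields and semi-Riemannian metrics\<close>

definition linear_on_subspace :: "'a::real_vector set \<Rightarrow> ('a \<Rightarrow> 'b::real_vector) \<Rightarrow> bool" where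
  "linear_on_subspace S F \<longleftrightarrow>
     (\<forall>u\<in>S. \<forall>w\<in>S. F (u + w) = F u + F w) \<and> (\<forall>c. \<forall>u\<in>S. F (c *\<^sub>R u) = c *\<^sub>R F u)"

definition tensor_field11 :: "('m, 'e::euclidean_space) atlas \<Rightarrow> 'm tensor11 \<Rightarrow> bool" where
  "tensor_field11 A P \<longleftrightarrow>
     (\<forall>p. P p ` tangent_space A p \<subseteq> tangent_space A p \<and> linear_on_subspace (tangent_space A p) (P p)) \<and>
     (\<forall>X. vector_field A X \<longrightarrow> vector_field A (\<lambda>p. P p (X p)))"

definition tensor_field02 :: "('m, 'e::euclidean_space) atlas \<Rightarrow> 'm tensor02 \<Rightarrow> bool" where
  "tensor_field02 A g \<longleftrightarrow>
     (\<forall>p. \<forall>u\<in>tangent_space A p.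
        linear_on_subspace (tangent_space A p) (g p u) \<and>
        linear_on_subspace (tangent_space A p) (\<lambda>w. g p w u)) \<and>
     (\<forall>X Y. vector_field A X \<longrightarrow> vector_field A Y \<longrightarrow> smooth_fun A (\<lambda>p. g p (X p) (Y p)))"

definition nondegenerate_on :: "'a::real_vector set \<Rightarrow> ('a \<Rightarrow> 'a \<Rightarrow> real) \<Rightarrow> bool" where
  "nondegenerate_on S b \<longleftrightarrow> (\<forall>u\<in>S. (\<forall>w\<in>S. b u w = 0) \<longrightarrow> u = 0)"

definition form_index :: "'a::real_vector set \<Rightarrow> ('a \<Rightarrow> 'a \<Rightarrow> real) \<Rightarrow> nat" where
  "form_index S b = (GREATEST k. \<exists>W. subspace W \<and> W \<subseteq> S \<and> dim W = k \<and> (\<forall>w\<in>W. w \<noteq> 0 \<longrightarrow> b w w < 0))"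

definition semi_riemannian_metric ::
  "('m, 'e::euclidean_space) atlas \<Rightarrow> 'm tensor02 \<Rightarrow> nat \<Rightarrow> bool" where
  "semi_riemannian_metric A g s \<longleftrightarrow> tensor_field02 A g \<and>
     (\<forall>p. \<forall>u\<in>tangent_space A p. \<forall>w\<in>tangent_space A p. g p u w = g p w u) \<and>
     (\<forall>p. nondegenerate_on (tangent_space A p) (g p)) \<and>
     (\<forall>p. form_index (tangent_space A p) (g p) = s)"

definition semi_riemannian_manifold ::
  "('m::{t2_space,second_countable_topology}, 'e::euclidean_space) atlas \<Rightarrow> 'm tensor02 \<Rightarrow> bool" where
  "semi_riemannian_manifold A g \<longleftrightarrow> smooth_manifold A \<and> (\<exists>s. semi_riemannian_metric A g s)"

section \<open>Connections and statistical structures\<close>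

definition affine_connection :: "('m, 'e::euclidean_space) atlas \<Rightarrow> 'm connection \<Rightarrow> bool" where
  "affine_connection A nab \<longleftrightarrow>
     (\<forall>X Y. vector_field A X \<longrightarrow> vector_field A Y \<longrightarrow> vector_field A (nab X Y)) \<and>
     (\<forall>X X' Y. vector_field A X \<longrightarrow> vector_field A X' \<longrightarrow> vector_field A Y \<longrightarrow>
        nab (\<lambda>p. X p + X' p) Y = (\<lambda>p. nab X Y p + nab X' Y p)) \<and>
     (\<forall>f X Y. smooth_fun A f \<longrightarrow> vector_field A X \<longrightarrow> vector_field A Y \<longrightarrow>
        nab (\<lambda>p. f p *\<^sub>R X p) Y = (\<lambda>p. f p *\<^sub>R nab X Y p)) \<and>
     (\<forall>X Y Y'. vector_field A X \<longrightarrow> vector_field A Y \<longrightarrow> vector_field A Y' \<longrightarrow>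
        nab X (\<lambda>p. Y p + Y' p) = (\<lambda>p. nab X Y p + nab X Y' p)) \<and>
     (\<forall>f X Y. smooth_fun A f \<longrightarrow> vector_field A X \<longrightarrow> vector_field A Y \<longrightarrow>
        nab X (\<lambda>p. f p *\<^sub>R Y p) = (\<lambda>p. X p f *\<^sub>R Y p + f p *\<^sub>R nab X Y p))"

definition torsion_free :: "('m, 'e::euclidean_space) atlas \<Rightarrow> 'm connection \<Rightarrow> bool" where
  "torsion_free A nab \<longleftrightarrow> (\<forall>E F. vector_field A E \<longrightarrow> vector_field A F \<longrightarrow>
     (\<forall>p. nab E F p - nab F E p = lie_bracket E F p))"

definition cov_deriv_metric ::
  "'m connection \<Rightarrow> 'm tensor02 \<Rightarrow> 'm vfield \<Rightarrow> 'm vfield \<Rightarrow> 'm vfield \<Rightarrow> 'm \<Rightarrow> real" where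
  "cov_deriv_metric nab g E F G p =
     E p (\<lambda>q. g q (F q) (G q)) - g p (nab E F p) (G p) - g p (F p) (nab E G p)"

definition cov_deriv11 :: "'m connection \<Rightarrow> 'm tensor11 \<Rightarrow> 'm vfield \<Rightarrow> 'm vfield \<Rightarrow> 'm vfield" where
  "cov_deriv11 nab P E F = (\<lambda>p. nab E (\<lambda>q. P q (F q)) p - P p (nab E F p))"

definition statistical_structure ::
  "('m, 'e::euclidean_space) atlas \<Rightarrow> 'm connection \<Rightarrow> 'm tensor02 \<Rightarrow> bool" where
  "statistical_structure A nab g \<longleftrightarrow> affine_connection A nab \<and> torsion_free A nab \<and>
     (\<forall>E F G. vector_field A E \<longrightarrow> vector_field A F \<longrightarrow> vector_field A G \<longrightarrow>
        (\<forall>p. cov_deriv_metric nab g E F G p = cov_deriv_metric nab g F E G p))"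

definition statistical_manifold ::
  "('m::{t2_space,second_countable_topology}, 'e::euclidean_space) atlas \<Rightarrow>
   'm connection \<Rightarrow> 'm tensor02 \<Rightarrow> bool" where
  "statistical_manifold A nab g \<longleftrightarrow> semi_riemannian_manifold A g \<and> statistical_structure A nab g"

definition conjugate_connection ::
  "('m, 'e::euclidean_space) atlas \<Rightarrow> 'm tensor02 \<Rightarrow> 'm connection \<Rightarrow> 'm connection \<Rightarrow> bool" where
  "conjugate_connection A g nab nabs \<longleftrightarrow> affine_connection A nabs \<and>
     (\<forall>E F G. vector_field A E \<longrightarrow> vector_field A F \<longrightarrow> vector_field A G \<longrightarrow>
        (\<forall>p. E p (\<lambda>q. g q (F q) (G q)) = g p (nab E F p) (G p) + g p (F p) (nabs E G p)))"

section \<open>Almost product structures\<close>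

definition almost_product_structure :: "('m, 'e::euclidean_space) atlas \<Rightarrow> 'm tensor11 \<Rightarrow> bool" where
  "almost_product_structure A P \<longleftrightarrow> tensor_field11 A P \<and>
     (\<forall>p. \<forall>u\<in>tangent_space A p. P p (P p u) = u) \<and>
     \<not> (\<forall>p. \<forall>u\<in>tangent_space A p. P p u = u) \<and>
     \<not> (\<forall>p. \<forall>u\<in>tangent_space A p. P p u = - u)"

definition almost_para_hermitian_like_manifold ::
  "('m::{t2_space,second_countable_topology}, 'e::euclidean_space) atlas \<Rightarrow>
   'm tensor11 \<Rightarrow> 'm tensor02 \<Rightarrow> bool" where
  "almost_para_hermitian_like_manifold A P g \<longleftrightarrow>
     semi_riemannian_manifold A g \<and> almost_product_structure A P"

text \<open>The condition \<open>g(P E, F) + g(E, P\<^sup>* F) = 0\<close> determines \<open>P\<^sup>*\<close> uniquely on tangent vectors.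
  If \<open>\<pi>\<close> is a submersion with \<open>\<pi>\<^sub>* P = P' \<pi>\<^sub>*\<close>, then \<open>P\<close> preserves the vertical spaces, but
  \<open>P\<^sup>*\<close> need not, as \<open>P\<close> need not preserve the horizontal spaces. A statement about the
  restriction of \<open>P\<^sup>*\<close> to the fibers has to carry the invariance as a hypothesis.\<close>

definition skew_adjoint_field ::
  "('m, 'e::euclidean_space) atlas \<Rightarrow> 'm tensor02 \<Rightarrow> 'm tensor11 \<Rightarrow> 'm tensor11 \<Rightarrow> bool" where
  "skew_adjoint_field A g P Ps \<longleftrightarrow> tensor_field11 A Ps \<and>
     (\<forall>E F. vector_field A E \<longrightarrow> vector_field A F \<longrightarrow>
        (\<forall>p. g p (P p (E p)) (F p) + g p (E p) (Ps p (F p)) = 0))"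

definition para_kaehler_like_statistical_manifold ::
  "('m::{t2_space,second_countable_topology}, 'e::euclidean_space) atlas \<Rightarrow>
   'm connection \<Rightarrow> 'm tensor11 \<Rightarrow> 'm tensor02 \<Rightarrow> bool" where
  "para_kaehler_like_statistical_manifold A nab P g \<longleftrightarrow>
     almost_para_hermitian_like_manifold A P g \<and> statistical_structure A nab g \<and>
     (\<forall>E F. vector_field A E \<longrightarrow> vector_field A F \<longrightarrow> (\<forall>p. cov_deriv11 nab P E F p = 0))"

section \<open>Submersions\<close>

text \<open>The tangent space at \<open>p\<close> of the fiber of a submersion \<open>\<pi>\<close> through \<open>p\<close> is the kernel of the
  differential of \<open>\<pi>\<close> at \<open>p\<close>.\<close>

definition vertical_space ::
  "('m, 'e::euclidean_space) atlas \<Rightarrow> ('n, 'f::euclidean_space) atlas \<Rightarrow> ('m \<Rightarrow> 'n) \<Rightarrow> 'm \<Rightarrow> 'm tvec set" where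
  "vertical_space A A' \<pi> p = {u \<in> tangent_space A p. pushforward A' \<pi> u = 0}"

definition horizontal_space ::
  "('m, 'e::euclidean_space) atlas \<Rightarrow> 'm tensor02 \<Rightarrow> ('n, 'f::euclidean_space) atlas \<Rightarrow> ('m \<Rightarrow> 'n) \<Rightarrow>
   'm \<Rightarrow> 'm tvec set" where
  "horizontal_space A g A' \<pi> p = {u \<in> tangent_space A p. \<forall>w\<in>vertical_space A A' \<pi> p. g p u w = 0}"

definition vproj ::
  "('m, 'e::euclidean_space) atlas \<Rightarrow> 'm tensor02 \<Rightarrow> ('n, 'f::euclidean_space) atlas \<Rightarrow> ('m \<Rightarrow> 'n) \<Rightarrow>
   'm tensor11" where
  "vproj A g A' \<pi> p u =
     (THE w. w \<in> vertical_space A A' \<pi> p \<and> u - w \<in> horizontal_space A g A' \<pi> p)"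

definition hproj ::
  "('m, 'e::euclidean_space) atlas \<Rightarrow> 'm tensor02 \<Rightarrow> ('n, 'f::euclidean_space) atlas \<Rightarrow> ('m \<Rightarrow> 'n) \<Rightarrow>
   'm tensor11" where
  "hproj A g A' \<pi> p u = u - vproj A g A' \<pi> p u"

definition vertical_field ::
  "('m, 'e::euclidean_space) atlas \<Rightarrow> ('n, 'f::euclidean_space) atlas \<Rightarrow> ('m \<Rightarrow> 'n) \<Rightarrow> 'm vfield \<Rightarrow> bool" where
  "vertical_field A A' \<pi> X \<longleftrightarrow> vector_field A X \<and> (\<forall>p. X p \<in> vertical_space A A' \<pi> p)"

definition horizontal_field ::
  "('m, 'e::euclidean_space) atlas \<Rightarrow> 'm tensor02 \<Rightarrow> ('n, 'f::euclidean_space) atlas \<Rightarrow> ('m \<Rightarrow> 'n) \<Rightarrow>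
   'm vfield \<Rightarrow> bool" where
  "horizontal_field A g A' \<pi> X \<longleftrightarrow> vector_field A X \<and> (\<forall>p. X p \<in> horizontal_space A g A' \<pi> p)"

text \<open>\<open>X\<close> is a basic vector field that is \<open>\<pi>\<close>-related to \<open>X'\<close>.\<close>

definition basic_field ::
  "('m, 'e::euclidean_space) atlas \<Rightarrow> 'm tensor02 \<Rightarrow> ('n, 'f::euclidean_space) atlas \<Rightarrow> ('m \<Rightarrow> 'n) \<Rightarrow>
   'm vfield \<Rightarrow> 'n vfield \<Rightarrow> bool" where
  "basic_field A g A' \<pi> X X' \<longleftrightarrow> horizontal_field A g A' \<pi> X \<and> vector_field A' X' \<and>
     (\<forall>p. pushforward A' \<pi> (X p) = X' (\<pi> p))"

definition semi_riemannian_submersion ::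
  "('m::{t2_space,second_countable_topology}, 'e::euclidean_space) atlas \<Rightarrow> 'm tensor02 \<Rightarrow>
   ('n::{t2_space,second_countable_topology}, 'f::euclidean_space) atlas \<Rightarrow> 'n tensor02 \<Rightarrow>
   ('m \<Rightarrow> 'n) \<Rightarrow> bool" where
  "semi_riemannian_submersion A g A' g' \<pi> \<longleftrightarrow>
     smooth_manifold A \<and> smooth_manifold A' \<and>
     connected (UNIV :: 'm set) \<and> connected (UNIV :: 'n set) \<and>
     (\<exists>s s'. semi_riemannian_metric A g s \<and> semi_riemannian_metric A' g' s' \<and> s' \<le> s) \<and>
     smooth_map A A' \<pi> \<and> surj \<pi> \<and>
     (\<forall>p. pushforward A' \<pi> ` tangent_space A p = tangent_space A' (\<pi> p)) \<and>
     (\<forall>p'. \<exists>r. \<forall>p\<in>\<pi> -` {p'}. nondegenerate_on (vertical_space A A' \<pi> p) (g p) \<and>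
        form_index (vertical_space A A' \<pi> p) (g p) = r) \<and>
     (\<forall>p. \<forall>u\<in>horizontal_space A g A' \<pi> p. \<forall>w\<in>horizontal_space A g A' \<pi> p.
        g' (\<pi> p) (pushforward A' \<pi> u) (pushforward A' \<pi> w) = g p u w)"

definition statistical_submersion ::
  "('m::{t2_space,second_countable_topology}, 'e::euclidean_space) atlas \<Rightarrow> 'm connection \<Rightarrow> 'm tensor02 \<Rightarrow>
   ('n::{t2_space,second_countable_topology}, 'f::euclidean_space) atlas \<Rightarrow> 'n connection \<Rightarrow> 'n tensor02 \<Rightarrow>
   ('m \<Rightarrow> 'n) \<Rightarrow> bool" where
  "statistical_submersion A nab g A' nab' g' \<pi> \<longleftrightarrow>
     statistical_manifold A nab g \<and> statistical_manifold A' nab' g' \<and>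
     semi_riemannian_submersion A g A' g' \<pi> \<and>
     (\<forall>X X' Y Y'. basic_field A g A' \<pi> X X' \<longrightarrow> basic_field A g A' \<pi> Y Y' \<longrightarrow>
        (\<forall>p. pushforward A' \<pi> (nab X Y p) = nab' X' Y' (\<pi> p)))"

definition almost_para_hermitian_like_statistical_submersion ::
  "('m::{t2_space,second_countable_topology}, 'e::euclidean_space) atlas \<Rightarrow> 'm connection \<Rightarrow>
   'm tensor11 \<Rightarrow> 'm tensor02 \<Rightarrow>
   ('n::{t2_space,second_countable_topology}, 'f::euclidean_space) atlas \<Rightarrow> 'n connection \<Rightarrow>
   'n tensor11 \<Rightarrow> 'n tensor02 \<Rightarrow> ('m \<Rightarrow> 'n) \<Rightarrow> bool" where
  "almost_para_hermitian_like_statistical_submersion A nab P g A' nab' P' g' \<pi> \<longleftrightarrow>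
     statistical_submersion A nab g A' nab' g' \<pi> \<and>
     almost_para_hermitian_like_manifold A P g \<and> almost_para_hermitian_like_manifold A' P' g' \<and>
     (\<forall>p. \<forall>u\<in>tangent_space A p. pushforward A' \<pi> (P p u) = P' (\<pi> p) (pushforward A' \<pi> u))"

definition para_kaehler_like_statistical_submersion ::
  "('m::{t2_space,second_countable_topology}, 'e::euclidean_space) atlas \<Rightarrow> 'm connection \<Rightarrow>
   'm tensor11 \<Rightarrow> 'm tensor02 \<Rightarrow>
   ('n::{t2_space,second_countable_topology}, 'f::euclidean_space) atlas \<Rightarrow> 'n connection \<Rightarrow>
   'n tensor11 \<Rightarrow> 'n tensor02 \<Rightarrow> ('m \<Rightarrow> 'n) \<Rightarrow> bool" where
  "para_kaehler_like_statistical_submersion A nab P g A' nab' P' g' \<pi> \<longleftrightarrow>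
     almost_para_hermitian_like_statistical_submersion A nab P g A' nab' P' g' \<pi> \<and>
     para_kaehler_like_statistical_manifold A nab P g"

section \<open>The fundamental tensors of a submersion\<close>

definition oneill_T ::
  "('m, 'e::euclidean_space) atlas \<Rightarrow> 'm tensor02 \<Rightarrow> ('n, 'f::euclidean_space) atlas \<Rightarrow> ('m \<Rightarrow> 'n) \<Rightarrow>
   'm connection \<Rightarrow> 'm vfield \<Rightarrow> 'm vfield \<Rightarrow> 'm vfield" where
  "oneill_T A g A' \<pi> nab E F =
     (let v = vproj A g A' \<pi>; h = hproj A g A' \<pi>;
          vE = (\<lambda>q. v q (E q)); vF = (\<lambda>q. v q (F q)); hF = (\<lambda>q. h q (F q))
      in (\<lambda>p. h p (nab vE vF p) + v p (nab vE hF p)))"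

definition oneill_A ::
  "('m, 'e::euclidean_space) atlas \<Rightarrow> 'm tensor02 \<Rightarrow> ('n, 'f::euclidean_space) atlas \<Rightarrow> ('m \<Rightarrow> 'n) \<Rightarrow>
   'm connection \<Rightarrow> 'm vfield \<Rightarrow> 'm vfield \<Rightarrow> 'm vfield" where
  "oneill_A A g A' \<pi> nab E F =
     (let v = vproj A g A' \<pi>; h = hproj A g A' \<pi>;
          hE = (\<lambda>q. h q (E q)); vF = (\<lambda>q. v q (F q)); hF = (\<lambda>q. h q (F q))
      in (\<lambda>p. v p (nab hE hF p) + h p (nab hE vF p)))"

text \<open>Rank of a linear map on a subspace \<open>S\<close> of a real vector space.\<close>

definition rank_on :: "'a::real_vector set \<Rightarrow> ('a \<Rightarrow> 'b::real_vector) \<Rightarrow> nat" where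
  "rank_on S F = dim (F ` S)"

end

theory Submission
  imports Defs
begin

text \<open>Write \<open>v\<close> and \<open>h\<close> for the projections on vertical and horizontal vectors.

  For vertical fields the first claim is pure algebra. As \<open>P\<close> preserves vertical vectors, \<open>h (P w)\<close>
  depends only on \<open>w\<close> modulo vertical vectors; \<open>P\<close> commutes with \<open>\<nabla>\<close>; and \<open>\<nabla>\<^sub>U V\<close> is symmetric
  modulo vertical vectors, because brackets of vertical fields are vertical. Hence
  \<open>h \<nabla>\<^bsub>PU\<^esub> PV = h P \<nabla>\<^bsub>PU\<^esub> V = h P \<nabla>\<^sub>V PU = h P P \<nabla>\<^sub>V U = h \<nabla>\<^sub>U V\<close>.

  The second claim comes from the identity \<open>g (P \<nabla>\<^sub>X Y, U) = g (\<nabla>\<^sub>X Y, P U)\<close> for horizontal \<open>X, Y\<close> and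
  vertical \<open>U\<close>. By definition of \<open>P\<^sup>*\<close> its right-hand side is \<open>- g (P\<^sup>* \<nabla>\<^sub>X Y, U)\<close>, so the vertical
  part of \<open>(P + P\<^sup>*) \<nabla>\<^sub>X Y\<close> vanishes. Since \<open>P\<close> and \<open>P\<^sup>*\<close> preserve vertical vectors and are adjoint
  up to sign, they also preserve horizontal vectors. This vertical part is therefore
  \<open>(P + P\<^sup>*) v \<nabla>\<^sub>X Y\<close>, and the rank condition gives \<open>v \<nabla>\<^sub>X Y = 0\<close>. For the conjugate connection
  \<open>g (\<nabla>\<^sup>*\<^sub>X Y, U) = - g (Y, \<nabla>\<^sub>X U) = - g (\<nabla>\<^sub>Y X, U)\<close> reduces the claim to the previous one.

  The identity is obtained by moving \<open>P\<close> from one argument to the other: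
  \<open>g (P \<nabla>\<^sub>X Y, U) = g (\<nabla>\<^sub>X PY, U)\<close>, which the exchange rule
  \<open>g (\<nabla>\<^sub>X Z, U) = g (\<nabla>\<^sub>U Z - [U, Z], X) = g (\<nabla>\<^sub>Z U, X)\<close>, applied to \<open>Z = PY\<close> and then to \<open>Z = Y\<close>
  and \<open>PU\<close>, turns into \<open>g (P (\<nabla>\<^sub>U Y - [U, Y]), X) = g (P \<nabla>\<^sub>Y U, X) = g (\<nabla>\<^sub>Y PU, X) = g (\<nabla>\<^sub>X Y, PU)\<close>.
  The usual argument takes \<open>X\<close> and \<open>Y\<close> basic, so that \<open>U g (X, Y) = 0\<close> and \<open>[U, X]\<close> is vertical, and
  then extends the result by smooth horizontal lifts and tensoriality of \<open>A\<close>. For arbitrary horizontal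
  fields the same argument goes through with two invariance properties in their place: the Lie derivative
  of \<open>g\<close> along \<open>U\<close> vanishes on horizontal fields (\<open>derivative_horizontal_horizontal\<close>), because
  there \<open>g\<close> is pulled back from the base, and the Lie derivative of \<open>P\<close> along \<open>U\<close> takes
  vertical values (\<open>P_lie_derivative_vertical\<close>), because \<open>P\<close> is \<open>\<pi>\<close>-related to \<open>P'\<close>.

  Everything is evaluated at one point \<open>p\<close> and involves one derivative of \<open>U\<close>, so it suffices that
  \<open>U\<close> is vertical at \<open>p\<close> up to first order. Such a field through a given vertical vector arises
  from an arbitrary extension by subtracting finitely many multiples of fixed fields
  (\<open>first_order_extension\<close>).
  Coordinates are supplied by globally defined functions and fields that restrict to a chart
  frame near a given point (\<open>local_frame_exists\<close>), cut off by bump functions.\<close>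

section \<open>Calculus of continuously differentiable functions\<close>

lemma has_derivative_Ck_on:
  assumes "Ck_on (Suc k) S f" "x \<in> S"
  shows "(f has_derivative frechet_derivative f (at x)) (at x)"
  using assms by (simp add: frechet_derivative_works)

lemma Ck_on_subset: "Ck_on k S f \<Longrightarrow> T \<subseteq> S \<Longrightarrow> Ck_on k T f"
  by (induction k arbitrary: f) (auto intro: continuous_on_subset)

lemma Ck_on_cong:
  assumes "open S" and "\<And>x. x \<in> S \<Longrightarrow> f x = g x" and "Ck_on k S f"
  shows "Ck_on k S g"
  using assms(2,3)
proof (induction k arbitrary: f g)
  case 0
  then show ?case by (metis Ck_on.simps(1) continuous_on_cong)
next
  case (Suc k)
  have g: "(g has_derivative frechet_derivative f (at x)) (at x)" if "x \<in> S" for x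
    using has_derivative_transform_within_open[OF has_derivative_Ck_on[OF Suc.prems(2) that] assms(1) that]
      Suc.prems(1) by blast
  have "Ck_on k S (\<lambda>x. frechet_derivative g (at x) v)" for v
    by (rule Suc.IH[of "\<lambda>x. frechet_derivative f (at x) v"])
       (use Suc.prems(2) frechet_derivative_at[OF g] in auto)
  then show ?case
    using g by (auto simp: differentiable_def)
qed

lemma Ck_on_Suc_I:
  assumes "open S" and "\<And>x. x \<in> S \<Longrightarrow> (f has_derivative f' x) (at x)"
    and "\<And>v. Ck_on k S (\<lambda>x. f' x v)"
  shows "Ck_on (Suc k) S f"
proof -
  have "Ck_on k S (\<lambda>x. frechet_derivative f (at x) v)" for v
    by (rule Ck_on_cong[OF assms(1) _ assms(3)[of v]])
       (use frechet_derivative_at[OF assms(2)] in auto)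
  then show ?thesis using assms(2) by (auto simp: differentiable_def)
qed

lemma Ck_on_SucD: "Ck_on (Suc k) S f \<Longrightarrow> Ck_on k S f"
proof (induction k arbitrary: f)
  case 0
  then show ?case
    by (auto intro!: continuous_at_imp_continuous_on differentiable_imp_continuous_within)
next
  case (Suc k)
  have "Ck_on k S (\<lambda>x. frechet_derivative f (at x) v)" for v
    by (rule Suc.IH) (use Suc.prems in simp)
  moreover have "\<forall>x\<in>S. f differentiable (at x)" using Suc.prems by simp
  ultimately show ?case by simp
qed

text \<open>The derivative at a point is that of a full neighbourhood, so being of class \<open>C\<^sup>k\<close> is a local
  property on the domain side.\<close>

lemma Ck_on_local:
  assumes "\<And>x. x \<in> S \<Longrightarrow> \<exists>T. open T \<and> x \<in> T \<and> Ck_on k T f"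
  shows "Ck_on k S f"
  using assms
proof (induction k arbitrary: f)
  case 0
  show ?case
  proof (simp, rule continuous_at_imp_continuous_on, rule)
    fix x assume "x \<in> S"
    then obtain T where "open T" "x \<in> T" "continuous_on T f" using 0[OF \<open>x \<in> S\<close>] by auto
    then show "isCont f x" by (simp add: continuous_on_eq_continuous_at)
  qed
next
  case (Suc k)
  have "f differentiable at x" if "x \<in> S" for x
    using Suc.prems[OF that] by auto
  moreover have "Ck_on k S (\<lambda>x. frechet_derivative f (at x) v)" for v
  proof (rule Suc.IH)
    fix x assume "x \<in> S"
    then obtain T where "open T" "x \<in> T" "Ck_on (Suc k) T f" using Suc.prems by blast
    then show "\<exists>T. open T \<and> x \<in> T \<and> Ck_on k T (\<lambda>x. frechet_derivative f (at x) v)"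
      by auto
  qed
  ultimately show ?case by simp
qed

lemma Ck_on_const: "open S \<Longrightarrow> Ck_on k S (\<lambda>x. c)"
proof (induction k arbitrary: c)
  case (Suc k)
  show ?case by (rule Ck_on_Suc_I[where f' = "\<lambda>x v. 0"]) (use Suc in auto)
qed simp

lemma Ck_on_bounded_linear: "bounded_linear f \<Longrightarrow> open S \<Longrightarrow> Ck_on k S f"
proof (cases k)
  case (Suc n)
  assume f: "bounded_linear f" "open S"
  show ?thesis unfolding Suc
    by (rule Ck_on_Suc_I[where f' = "\<lambda>x. f"])
       (use f in \<open>auto intro: Ck_on_const bounded_linear_imp_has_derivative\<close>)
qed (simp add: linear_continuous_on)

lemma Ck_on_add:
  "open S \<Longrightarrow> Ck_on k S f \<Longrightarrow> Ck_on k S g \<Longrightarrow> Ck_on k S (\<lambda>x. f x + g x)"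
proof (induction k arbitrary: f g)
  case (Suc k)
  show ?case
    by (rule Ck_on_Suc_I[OF Suc.prems(1)
          has_derivative_add[OF has_derivative_Ck_on[OF Suc.prems(2)] has_derivative_Ck_on[OF Suc.prems(3)]]])
       (use Suc in auto)
qed (auto intro: continuous_on_add)

lemma Ck_on_sum:
  "open S \<Longrightarrow> (\<And>i. i \<in> I \<Longrightarrow> Ck_on k S (f i)) \<Longrightarrow> Ck_on k S (\<lambda>x. \<Sum>i\<in>I. f i x)"
  by (induction I rule: infinite_finite_induct) (auto intro: Ck_on_const Ck_on_add)

lemma Ck_on_scaleR:
  fixes f :: "_ \<Rightarrow> real"
  shows "open S \<Longrightarrow> Ck_on k S f \<Longrightarrow> Ck_on k S g \<Longrightarrow> Ck_on k S (\<lambda>x. f x *\<^sub>R g x)"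
proof (induction k arbitrary: f g)
  case (Suc k)
  show ?case
    by (rule Ck_on_Suc_I[OF Suc.prems(1)
          has_derivative_scaleR[OF has_derivative_Ck_on[OF Suc.prems(2)] has_derivative_Ck_on[OF Suc.prems(3)]]])
       (use Suc.prems Suc.prems(2,3)[THEN Ck_on_SucD] in \<open>auto intro!: Ck_on_add Suc.IH\<close>)
qed (auto intro: continuous_on_scaleR)

lemma Ck_on_inner_left: "open S \<Longrightarrow> Ck_on k S f \<Longrightarrow> Ck_on k S (\<lambda>x. f x \<bullet> b)"
proof (induction k arbitrary: f)
  case (Suc k)
  show ?case
    by (rule Ck_on_Suc_I[OF Suc.prems(1) has_derivative_inner_left[OF has_derivative_Ck_on[OF Suc.prems(2)]]])
       (use Suc in auto)
qed (auto intro: continuous_intros)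

text \<open>The chain rule gives the derivative of \<open>f \<circ> g\<close> as the derivative of \<open>f\<close> in a direction that
  moves with the point. Expanding that direction in the standard basis leaves derivatives of \<open>f\<close>
  in fixed directions composed with \<open>g\<close>, to which the induction hypothesis applies.\<close>

lemma Ck_on_compose:
  fixes f :: "'b::euclidean_space \<Rightarrow> 'c::real_normed_vector" and g :: "'a::euclidean_space \<Rightarrow> 'b"
  assumes "open S" "open T" "g ` S \<subseteq> T"
  shows "Ck_on k T f \<Longrightarrow> Ck_on k S g \<Longrightarrow> Ck_on k S (\<lambda>x. f (g x))"
proof (induction k arbitrary: f)
  case 0
  then show ?case
    using assms by (auto intro: continuous_on_compose2)
next
  case (Suc k)
  let ?f' = "\<lambda>x v. \<Sum>b\<in>Basis. (frechet_derivative g (at x) v \<bullet> b) *\<^sub>R frechet_derivative f (at (g x)) b"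
  show ?case
  proof (rule Ck_on_Suc_I[where f' = ?f'])
    fix x assume x: "x \<in> S"
    have f: "(f has_derivative frechet_derivative f (at (g x))) (at (g x))"
      by (rule has_derivative_Ck_on[OF Suc.prems(1)]) (use x assms in auto)
    interpret bounded_linear "frechet_derivative f (at (g x))"
      using f by (rule has_derivative_bounded_linear)
    have "frechet_derivative f (at (g x)) w = (\<Sum>b\<in>Basis. (w \<bullet> b) *\<^sub>R frechet_derivative f (at (g x)) b)" for w
      by (subst euclidean_representation[symmetric, of w]) (simp only: sum scaleR)
    then have "?f' x = (\<lambda>v. frechet_derivative f (at (g x)) (frechet_derivative g (at x) v))"
      by (intro ext) metis
    with has_derivative_compose[OF has_derivative_Ck_on[OF Suc.prems(2) x] f]
    show "((\<lambda>x. f (g x)) has_derivative ?f' x) (at x)"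
      by (simp only:)
  next
    fix v
    have g: "Ck_on k S (\<lambda>x. frechet_derivative g (at x) v)" for v using Suc.prems(2) by simp
    have gb: "Ck_on k S (\<lambda>x. frechet_derivative g (at x) v \<bullet> b)" for b
      by (rule Ck_on_inner_left[OF assms(1) g])
    show "Ck_on k S (\<lambda>x. ?f' x v)"
      using Suc.prems Ck_on_SucD
      by (intro Ck_on_sum Ck_on_scaleR gb Suc.IH assms(1)) auto
  qed (rule assms(1))
qed

lemma smooth_on_cong:
  "open S \<Longrightarrow> (\<And>x. x \<in> S \<Longrightarrow> f x = g x) \<Longrightarrow> smooth_on S f \<Longrightarrow> smooth_on S g"
  unfolding smooth_on_def using Ck_on_cong by blast

lemma smooth_on_subset: "smooth_on S f \<Longrightarrow> T \<subseteq> S \<Longrightarrow> smooth_on T f"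
  unfolding smooth_on_def using Ck_on_subset by blast

lemma smooth_on_local:
  "(\<And>x. x \<in> S \<Longrightarrow> \<exists>T. open T \<and> x \<in> T \<and> smooth_on T f) \<Longrightarrow> smooth_on S f"
  unfolding smooth_on_def by (metis Ck_on_local)

lemma smooth_on_const: "open S \<Longrightarrow> smooth_on S (\<lambda>x. c)"
  unfolding smooth_on_def by (simp add: Ck_on_const)

lemma smooth_on_bounded_linear: "bounded_linear f \<Longrightarrow> open S \<Longrightarrow> smooth_on S f"
  unfolding smooth_on_def by (simp add: Ck_on_bounded_linear)

lemma smooth_on_add:
  "open S \<Longrightarrow> smooth_on S f \<Longrightarrow> smooth_on S g \<Longrightarrow> smooth_on S (\<lambda>x. f x + g x)"
  unfolding smooth_on_def by (simp add: Ck_on_add)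

lemma smooth_on_sum:
  "open S \<Longrightarrow> (\<And>i. i \<in> I \<Longrightarrow> smooth_on S (f i)) \<Longrightarrow> smooth_on S (\<lambda>x. \<Sum>i\<in>I. f i x)"
  unfolding smooth_on_def by (simp add: Ck_on_sum)

lemma smooth_on_mult:
  fixes f g :: "_ \<Rightarrow> real"
  shows "open S \<Longrightarrow> smooth_on S f \<Longrightarrow> smooth_on S g \<Longrightarrow> smooth_on S (\<lambda>x. f x * g x)"
  unfolding smooth_on_def using Ck_on_scaleR[of S _ f g] by simp

lemma smooth_on_compose:
  "open S \<Longrightarrow> open T \<Longrightarrow> g ` S \<subseteq> T \<Longrightarrow> smooth_on T f \<Longrightarrow> smooth_on S g \<Longrightarrow> smooth_on S (\<lambda>x. f (g x))"
  unfolding smooth_on_def using Ck_on_compose by blast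

lemma smooth_on_differentiable: "smooth_on S f \<Longrightarrow> x \<in> S \<Longrightarrow> f differentiable (at x)"
  unfolding smooth_on_def by (drule spec[of _ "Suc 0"]) simp

lemma smooth_on_derivative: "smooth_on S f \<Longrightarrow> smooth_on S (\<lambda>x. frechet_derivative f (at x) v)"
  unfolding smooth_on_def by (metis Ck_on.simps(2))

section \<open>Bump functions\<close>

text \<open>The factors \<open>(1/t) ^ n\<close> make the span of the family closed under differentiation, so that
  its smoothness follows by an induction on the order that treats all \<open>n\<close> at once.\<close>

definition flat_exp :: "nat \<Rightarrow> real \<Rightarrow> real" where
  "flat_exp n t = (if t > 0 then (1/t)^n * exp (-(1/t)) else 0)"

lemma flat_exp_tendsto_0: "((\<lambda>t. flat_exp n t) \<longlongrightarrow> 0) (at 0)"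
proof -
  have "((\<lambda>t::real. (1/t)^n * exp (-(1/t))) \<longlongrightarrow> 0) (at_right 0)"
  proof -
    have "filterlim (\<lambda>t::real. 1/t) at_top (at_right 0)"
      using filterlim_inverse_at_top_right by (simp add: inverse_eq_divide)
    from filterlim_compose[OF tendsto_power_div_exp_0 this, of n]
    show ?thesis by (simp add: exp_minus divide_inverse)
  qed
  then have "(flat_exp n \<longlongrightarrow> 0) (at_right 0)"
    by (rule Lim_transform_eventually)
       (auto simp: eventually_at_right_field flat_exp_def intro!: exI[of _ 1])
  moreover have "(flat_exp n \<longlongrightarrow> 0) (at_left 0)"
    by (rule tendsto_eventually) (auto simp: eventually_at_left_field flat_exp_def intro!: exI[of _ "-1"])
  ultimately show ?thesis using filterlim_at_split by blast
qed

lemma flat_exp_has_derivative: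
  "(flat_exp n has_real_derivative (flat_exp (n+2) t - real n * flat_exp (n+1) t)) (at t)"
proof (cases t "0::real" rule: linorder_cases)
  case less
  have "((\<lambda>t::real. 0::real) has_real_derivative 0) (at t)" by simp
  then have "(flat_exp n has_real_derivative 0) (at t)"
    by (rule has_field_derivative_transform_within_open[of _ _ _ "{..<0}"])
       (use less in \<open>auto simp: flat_exp_def\<close>)
  then show ?thesis using less by (simp add: flat_exp_def)
next
  case greater
  have "((\<lambda>t::real. (1/t)^n * exp (-(1/t))) has_real_derivative
      (real n * (1/t)^(n-1) * (- (1/t^2))) * exp (-(1/t)) + (1/t)^n * (exp (-(1/t)) * (1/t^2))) (at t)"
    using greater by (auto intro!: derivative_eq_intros simp: power2_eq_square)
  moreover have "real n * (1/t)^(n-1) * (- (1/t^2)) = - real n * (1/t)^(n+1)"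
  proof (cases n)
    case (Suc m)
    then show ?thesis using greater by (simp add: field_simps power2_eq_square)
  qed simp
  then have "(real n * (1/t)^(n-1) * (- (1/t^2))) * exp (-(1/t)) + (1/t)^n * (exp (-(1/t)) * (1/t^2))
      = flat_exp (n+2) t - real n * flat_exp (n+1) t"
    using greater by (simp only: flat_exp_def) (simp add: power_add power_divide power2_eq_square algebra_simps)
  ultimately have "((\<lambda>t::real. (1/t)^n * exp (-(1/t))) has_real_derivative
      flat_exp (n+2) t - real n * flat_exp (n+1) t) (at t)"
    by (simp only:)
  then show ?thesis
    by (rule has_field_derivative_transform_within_open[of _ _ _ "{0<..}"])
       (use greater in \<open>auto simp: flat_exp_def\<close>)
next
  case equal
  have "((\<lambda>y. (flat_exp n y - flat_exp n 0) / (y - 0)) \<longlongrightarrow> 0) (at 0)"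
    \<comment> \<open>the difference quotient is the next member of the family\<close>
    by (rule Lim_transform_eventually[OF flat_exp_tendsto_0[of "Suc n"]])
       (auto simp: flat_exp_def intro!: always_eventually)
  then show ?thesis using equal
    by (simp add: has_field_derivative_iff flat_exp_def)
qed

lemma smooth_flat_exp: "smooth_on UNIV (flat_exp n)"
proof -
  have "Ck_on k UNIV (flat_exp n)" for k
  proof (induction k arbitrary: n)
    case 0
    show ?case
      using flat_exp_has_derivative DERIV_isCont continuous_at_imp_continuous_on by (metis Ck_on.simps(1))
  next
    case (Suc k)
    have "Ck_on k UNIV (\<lambda>x. (v *\<^sub>R flat_exp (n+2) x) + ((- v * real n) *\<^sub>R flat_exp (n+1) x))" for v
      by (intro Ck_on_add Ck_on_scaleR Suc Ck_on_const open_UNIV)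
    then show ?case
      by (intro Ck_on_Suc_I[OF open_UNIV flat_exp_has_derivative[unfolded has_field_derivative_def]])
         (auto simp: algebra_simps)
  qed
  then show ?thesis by (simp add: smooth_on_def)
qed

text \<open>With \<open>\<eta>\<close> denoting \<open>exp (-1/t)\<close> extended by zero, the function
  \<open>t \<mapsto> \<eta> (\<eta> 1 - \<eta> t) / \<eta> (\<eta> 1)\<close> equals 1 for \<open>t \<le> 0\<close> and 0 for \<open>t \<ge> 1\<close>, since \<open>\<eta>\<close> is
  nondecreasing. This function is
  composed with the affine function of the squared radius that is 0 on the inner and 1 on the outer sphere.\<close>

lemma smooth_bump:
  fixes x0 :: "'a::euclidean_space"
  assumes "0 < r" "r < R"
  obtains \<beta> :: "'a \<Rightarrow> real" where "smooth_on UNIV \<beta>"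
    "\<And>x. x \<in> ball x0 r \<Longrightarrow> \<beta> x = 1" "\<And>x. x \<notin> ball x0 R \<Longrightarrow> \<beta> x = 0"
proof -
  let ?h = "flat_exp 0"
  let ?\<rho> = "\<lambda>x. ((x - x0) \<bullet> (x - x0) - r\<^sup>2) * (1 / (R\<^sup>2 - r\<^sup>2))"
  let ?\<beta> = "\<lambda>x. ?h (?h 1 + (-1) * ?h (?\<rho> x)) * (1 / ?h (?h 1))"
  have pos: "R\<^sup>2 - r\<^sup>2 > 0" using assms by (simp add: power_strict_mono)
  have h1: "?h 1 > 0" by (simp add: flat_exp_def)
  have mono: "?h 1 \<le> ?h t" if "t \<ge> 1" for t
    using that by (simp add: flat_exp_def)
  have eq: "?\<rho> = (\<lambda>x. ((\<Sum>b\<in>Basis. (x \<bullet> b + (- (x0 \<bullet> b))) * (x \<bullet> b + (- (x0 \<bullet> b)))) + (- r\<^sup>2)) * (1 / (R\<^sup>2 - r\<^sup>2)))"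
    by (rule ext) (subst euclidean_inner, simp add: inner_diff_left)
  have "smooth_on UNIV ?\<rho>"
    unfolding eq
    by (intro smooth_on_mult smooth_on_add smooth_on_sum smooth_on_const smooth_on_bounded_linear
        bounded_linear_inner_left open_UNIV)
  then have "smooth_on UNIV (\<lambda>x. ?h (?\<rho> x))"
    by (rule smooth_on_compose[OF open_UNIV open_UNIV subset_UNIV smooth_flat_exp])
  then have "smooth_on UNIV (\<lambda>x. ?h 1 + (-1) * ?h (?\<rho> x))"
    by (rule smooth_on_add[OF open_UNIV smooth_on_const[OF open_UNIV]
          smooth_on_mult[OF open_UNIV smooth_on_const[OF open_UNIV]]])
  then have "smooth_on UNIV (\<lambda>x. ?h (?h 1 + (-1) * ?h (?\<rho> x)))"
    by (rule smooth_on_compose[OF open_UNIV open_UNIV subset_UNIV smooth_flat_exp])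
  then have "smooth_on UNIV ?\<beta>"
    by (rule smooth_on_mult[OF open_UNIV _ smooth_on_const[OF open_UNIV]])
  moreover have "?\<beta> x = 1" if "x \<in> ball x0 r" for x
  proof -
    have "(x - x0) \<bullet> (x - x0) \<le> r\<^sup>2"
      using that assms by (auto simp: dist_norm norm_minus_commute dot_square_norm intro!: power_mono)
    then have "?\<rho> x \<le> 0" using pos by (simp add: divide_nonpos_pos)
    then have "?h (?\<rho> x) = 0" by (simp add: flat_exp_def)
    then show ?thesis using h1 by (simp add: flat_exp_def)
  qed
  moreover have "?\<beta> x = 0" if "x \<notin> ball x0 R" for x
  proof -
    have "(x - x0) \<bullet> (x - x0) \<ge> R\<^sup>2"
      using that assms by (auto simp: dist_norm norm_minus_commute dot_square_norm intro!: power_mono)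
    then have "?\<rho> x \<ge> 1" using pos by simp
    then have "?h 1 + (-1) * ?h (?\<rho> x) \<le> 0" using mono[of "?\<rho> x"] by linarith
    moreover have "?h s = 0" if "s \<le> 0" for s using that by (simp add: flat_exp_def)
    ultimately show ?thesis by (metis mult_zero_left)
  qed
  ultimately show thesis by (rule that)
qed

section \<open>Functions, tangent vectors and frames on a manifold\<close>

definition chart_vector ::
  "('m, 'e::euclidean_space) atlas \<Rightarrow> 'm set \<Rightarrow> ('m \<Rightarrow> 'e) \<Rightarrow> 'm \<Rightarrow> 'e \<Rightarrow> 'm tvec" where
  "chart_vector A U \<phi> p v =
     (\<lambda>f. if smooth_fun A f then frechet_derivative (f \<circ> inv_into U \<phi>) (at (\<phi> p)) v else 0)"

text \<open>Global functions \<open>y b\<close> and global fields \<open>W b\<close> that behave on \<open>N\<close> like the coordinates and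
  coordinate fields of a chart. Tangent vectors act on globally smooth functions only, which is why
  neither family is defined just on \<open>N\<close>.\<close>

definition local_frame ::
  "('m::topological_space, 'e::euclidean_space) atlas \<Rightarrow> 'm set \<Rightarrow> ('e \<Rightarrow> 'm \<Rightarrow> real) \<Rightarrow> ('e \<Rightarrow> 'm vfield) \<Rightarrow> bool" where
  "local_frame A N y W \<longleftrightarrow> open N \<and>
     (\<forall>b\<in>Basis. smooth_fun A (y b) \<and> vector_field A (W b)) \<and>
     (\<forall>q\<in>N. \<forall>b\<in>Basis. \<forall>c\<in>Basis. W b q (y c) = (if b = c then 1 else 0)) \<and>
     (\<forall>q\<in>N. \<forall>D\<in>tangent_space A q. D = (\<Sum>b\<in>Basis. D (y b) *\<^sub>R W b q))"

lemma sum_fun_apply: "(\<Sum>i\<in>I. F i) x = (\<Sum>i\<in>I. F i x)"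
  by (induction I rule: infinite_finite_induct) auto

lemma scaleR_fun_apply: "(c *\<^sub>R F) x = c *\<^sub>R F x"
  by (simp only: scaleR_fun_def)

locale manifold =
  fixes A :: "('m::{t2_space,second_countable_topology}, 'e::euclidean_space) atlas"
  assumes smooth_manifold: "smooth_manifold A"
begin

lemma chart_around: obtains U \<phi> where "(U, \<phi>) \<in> A" "p \<in> U"
proof -
  have "p \<in> (\<Union>(U, \<phi>)\<in>A. U)" using smooth_manifold by (simp add: smooth_manifold_def)
  then show thesis using that by fast
qed

lemma
  assumes "(U, \<phi>) \<in> A"
  shows chart_open: "open U" and chart_image_open: "open (\<phi> ` U)"
    and chart_homeomorphism: "\<exists>\<psi>. homeomorphism U (\<phi> ` U) \<phi> \<psi>"
  using bspec[OF conjunct1[OF conjunct2[OF smooth_manifold[unfolded smooth_manifold_def]]] assms] by simp_all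

lemma chart_transition:
  assumes "(U, \<phi>) \<in> A" "(V, \<psi>) \<in> A"
  shows "smooth_on (\<phi> ` (U \<inter> V)) (\<psi> \<circ> inv_into U \<phi>)"
  using bspec[OF bspec[OF conjunct2[OF conjunct2[OF smooth_manifold[unfolded smooth_manifold_def]]] assms(1),
        unfolded prod.case] assms(2)] by simp

lemma chart_inj: "(U, \<phi>) \<in> A \<Longrightarrow> inj_on \<phi> U"
  using chart_homeomorphism[of U \<phi>] by (metis homeomorphism_apply1 inj_on_inverseI)

lemma chart_inv [simp]: "(U, \<phi>) \<in> A \<Longrightarrow> q \<in> U \<Longrightarrow> inv_into U \<phi> (\<phi> q) = q"
  by (simp add: chart_inj inv_into_f_f)

lemma chart_inv_continuous:
  assumes "(U, \<phi>) \<in> A"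
  shows "continuous_on (\<phi> ` U) (inv_into U \<phi>)"
proof -
  obtain \<psi> where h: "homeomorphism U (\<phi> ` U) \<phi> \<psi>" using chart_homeomorphism[OF assms] by blast
  then have "continuous_on (\<phi> ` U) \<psi>" by (simp add: homeomorphism_def)
  moreover have "\<psi> x = inv_into U \<phi> x" if "x \<in> \<phi> ` U" for x
    using that h assms by (auto simp: homeomorphism_def)
  ultimately show ?thesis by (metis continuous_on_cong)
qed

lemma chart_open_map:
  assumes "(U, \<phi>) \<in> A" "open V" "V \<subseteq> U"
  shows "open (\<phi> ` V)"
proof -
  obtain \<psi> where h: "homeomorphism U (\<phi> ` U) \<phi> \<psi>" using chart_homeomorphism[OF assms(1)] by blast
  have "openin (top_of_set U) V" using assms chart_open by (simp add: openin_open_eq)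
  with h have "openin (top_of_set (\<phi> ` U)) (\<phi> ` V)" by (rule homeomorphism_imp_open_map)
  then show ?thesis using chart_image_open[OF assms(1)] by (simp add: openin_open_eq)
qed

lemma smooth_fun_chart: "smooth_fun A f \<Longrightarrow> (U, \<phi>) \<in> A \<Longrightarrow> smooth_on (\<phi> ` U) (f \<circ> inv_into U \<phi>)"
  unfolding smooth_fun_def by blast

lemma smooth_fun_const: "smooth_fun A (\<lambda>p. c)"
  unfolding smooth_fun_def o_def by (auto intro: smooth_on_const chart_image_open)

lemma smooth_fun_add: "smooth_fun A f \<Longrightarrow> smooth_fun A h \<Longrightarrow> smooth_fun A (\<lambda>p. f p + h p)"
  unfolding smooth_fun_def o_def
  by (auto intro!: smooth_on_add chart_image_open)

lemma smooth_fun_mult: "smooth_fun A f \<Longrightarrow> smooth_fun A h \<Longrightarrow> smooth_fun A (\<lambda>p. f p * h p)"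
  unfolding smooth_fun_def o_def
  by (auto intro!: smooth_on_mult chart_image_open)

lemma smooth_fun_sum: "(\<And>i. i \<in> I \<Longrightarrow> smooth_fun A (f i)) \<Longrightarrow> smooth_fun A (\<lambda>p. \<Sum>i\<in>I. f i p)"
  by (induction I rule: infinite_finite_induct) (auto intro: smooth_fun_const smooth_fun_add)

lemma chart_function_derivative:
  assumes "smooth_fun A f" "(U, \<phi>) \<in> A" "p \<in> U"
  shows "((f \<circ> inv_into U \<phi>) has_derivative frechet_derivative (f \<circ> inv_into U \<phi>) (at (\<phi> p))) (at (\<phi> p))"
  using smooth_on_differentiable[OF smooth_fun_chart[OF assms(1,2)]] assms(3)
  by (simp add: frechet_derivative_works)

lemma chart_vector_eqI:
  assumes "smooth_fun A f" "((f \<circ> inv_into U \<phi>) has_derivative F) (at (\<phi> p))"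
  shows "chart_vector A U \<phi> p v f = F v"
  using assms frechet_derivative_at[OF assms(2)] by (simp add: chart_vector_def)

lemma linear_chart_vector:
  assumes "(U, \<phi>) \<in> A" "p \<in> U"
  shows "linear (chart_vector A U \<phi> p)"
proof
  fix v w and c :: real
  have "linear (frechet_derivative (f \<circ> inv_into U \<phi>) (at (\<phi> p)))" if "smooth_fun A f" for f
    using chart_function_derivative[OF that assms] by (rule has_derivative_linear)
  then show "chart_vector A U \<phi> p (v + w) = chart_vector A U \<phi> p v + chart_vector A U \<phi> p w"
    and "chart_vector A U \<phi> p (c *\<^sub>R v) = c *\<^sub>R chart_vector A U \<phi> p v"
    by (auto simp: chart_vector_def fun_eq_iff scaleR_fun_apply linear_add linear_scale)
qed

text \<open>The differential of the transition map converts the coordinate vector in one chart into that in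
  another. Hence the tangent space, a union over all charts, is the image of a linear map.\<close>

lemma chart_vector_change:
  assumes "(U, \<phi>) \<in> A" "(V, \<psi>) \<in> A" "p \<in> U" "p \<in> V"
  shows "chart_vector A V \<psi> p v =
    chart_vector A U \<phi> p (frechet_derivative (\<phi> \<circ> inv_into V \<psi>) (at (\<psi> p)) v)"
proof
  fix f
  let ?\<tau> = "\<phi> \<circ> inv_into V \<psi>"
  show "chart_vector A V \<psi> p v f = chart_vector A U \<phi> p (frechet_derivative ?\<tau> (at (\<psi> p)) v) f"
  proof (cases "smooth_fun A f")
    case True
    let ?F = "frechet_derivative (f \<circ> inv_into U \<phi>) (at (\<phi> p))"
    have \<tau>: "(?\<tau> has_derivative frechet_derivative ?\<tau> (at (\<psi> p))) (at (\<psi> p))"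
      using smooth_on_differentiable[OF chart_transition[OF assms(2,1)]] assms(3,4)
      by (simp add: frechet_derivative_works)
    have "(f \<circ> inv_into U \<phi> has_derivative ?F) (at (?\<tau> (\<psi> p)))"
      using chart_function_derivative[OF True assms(1,3)] assms by simp
    from has_derivative_compose[OF \<tau> this]
    have "((\<lambda>x. (f \<circ> inv_into U \<phi>) (?\<tau> x)) has_derivative
        (\<lambda>v. ?F (frechet_derivative ?\<tau> (at (\<psi> p)) v))) (at (\<psi> p))" .
    then have "((f \<circ> inv_into V \<psi>) has_derivative
        (\<lambda>v. ?F (frechet_derivative ?\<tau> (at (\<psi> p)) v))) (at (\<psi> p))"
      by (rule has_derivative_transform_within_open[where s = "\<psi> ` (V \<inter> U)"])
         (use assms chart_open_map[OF assms(2), of "V \<inter> U"] chart_open in auto)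
    from chart_vector_eqI[OF True this] show ?thesis
      using True by (simp add: chart_vector_def)
  qed (simp add: chart_vector_def)
qed

lemma tangent_space_chart:
  assumes "(U, \<phi>) \<in> A" "p \<in> U"
  shows "tangent_space A p = range (chart_vector A U \<phi> p)"
proof
  show "tangent_space A p \<subseteq> range (chart_vector A U \<phi> p)"
    unfolding tangent_space_def
    using chart_vector_change[OF assms(1) _ assms(2)] by (auto simp: chart_vector_def)
  show "range (chart_vector A U \<phi> p) \<subseteq> tangent_space A p"
    unfolding tangent_space_def chart_vector_def using assms by blast
qed

lemma subspace_tangent_space: "subspace (tangent_space A p)"
proof -
  obtain U \<phi> where c: "(U, \<phi>) \<in> A" "p \<in> U" by (rule chart_around)
  then show ?thesis
    by (simp add: tangent_space_chart linear_subspace_image[OF linear_chart_vector])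
qed

lemma tangent_space_finite_dim: obtains B where "finite B" "tangent_space A p \<subseteq> span B"
proof -
  obtain U \<phi> where c: "(U, \<phi>) \<in> A" "p \<in> U" by (rule chart_around)
  have "tangent_space A p = span (chart_vector A U \<phi> p ` Basis)"
    using linear_span_image[OF linear_chart_vector[OF c], of Basis] by (simp add: tangent_space_chart[OF c])
  then show thesis using that[of "chart_vector A U \<phi> p ` Basis"] by simp
qed

lemma tangent_vector_local:
  assumes "D \<in> tangent_space A p" "smooth_fun A f" "smooth_fun A h"
    and "open N" "p \<in> N" "\<And>q. q \<in> N \<Longrightarrow> f q = h q"
  shows "D f = D h"
proof -
  obtain U \<phi> where c: "(U, \<phi>) \<in> A" "p \<in> U" by (rule chart_around)
  then obtain v where D: "D = chart_vector A U \<phi> p v" using assms(1) tangent_space_chart by auto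
  have "((f \<circ> inv_into U \<phi>) has_derivative frechet_derivative (h \<circ> inv_into U \<phi>) (at (\<phi> p))) (at (\<phi> p))"
    by (rule has_derivative_transform_within_open[OF chart_function_derivative[OF assms(3) c],
          where s = "\<phi> ` (U \<inter> N)"])
       (use assms c chart_open_map[OF c(1), of "U \<inter> N"] chart_open in auto)
  from chart_vector_eqI[OF assms(2) this] show ?thesis
    using assms(3) unfolding D by (simp add: chart_vector_def)
qed

lemma
  assumes "D \<in> tangent_space A p" "smooth_fun A f" "smooth_fun A h"
  shows tangent_vector_add: "D (\<lambda>q. f q + h q) = D f + D h"
    and tangent_vector_mult: "D (\<lambda>q. f q * h q) = D f * h p + f p * D h"
proof -
  obtain U \<phi> where c: "(U, \<phi>) \<in> A" "p \<in> U" by (rule chart_around)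
  then obtain v where D: "D = chart_vector A U \<phi> p v" using assms(1) tangent_space_chart by auto
  note fh = assms(2,3)[THEN chart_function_derivative, OF c]
  have "(((\<lambda>q. f q + h q) \<circ> inv_into U \<phi>) has_derivative
      (\<lambda>v. frechet_derivative (f \<circ> inv_into U \<phi>) (at (\<phi> p)) v
         + frechet_derivative (h \<circ> inv_into U \<phi>) (at (\<phi> p)) v)) (at (\<phi> p))"
    using has_derivative_add[OF fh] by (simp add: o_def)
  from chart_vector_eqI[OF smooth_fun_add[OF assms(2,3)] this]
  show "D (\<lambda>q. f q + h q) = D f + D h"
    using assms unfolding D by (simp add: chart_vector_def)
  have "(((\<lambda>q. f q * h q) \<circ> inv_into U \<phi>) has_derivative
      (\<lambda>v. (f \<circ> inv_into U \<phi>) (\<phi> p) * frechet_derivative (h \<circ> inv_into U \<phi>) (at (\<phi> p)) v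
         + frechet_derivative (f \<circ> inv_into U \<phi>) (at (\<phi> p)) v * (h \<circ> inv_into U \<phi>) (\<phi> p))) (at (\<phi> p))"
    using has_derivative_mult[OF fh] by (simp add: o_def)
  from chart_vector_eqI[OF smooth_fun_mult[OF assms(2,3)] this]
  show "D (\<lambda>q. f q * h q) = D f * h p + f p * D h"
    using assms c unfolding D by (simp add: chart_vector_def)
qed

lemma tangent_vector_const:
  assumes "D \<in> tangent_space A p"
  shows "D (\<lambda>q. c) = 0"
proof -
  obtain U \<phi> where ch: "(U, \<phi>) \<in> A" "p \<in> U" by (rule chart_around)
  then obtain v where D: "D = chart_vector A U \<phi> p v" using assms tangent_space_chart by auto
  have "(((\<lambda>q. c) \<circ> inv_into U \<phi>) has_derivative (\<lambda>v. 0)) (at (\<phi> p))"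
    by (simp add: o_def)
  from chart_vector_eqI[OF smooth_fun_const this] show ?thesis by (simp add: D)
qed

lemma tangent_vector_sum:
  assumes "D \<in> tangent_space A p" "\<And>i. i \<in> I \<Longrightarrow> smooth_fun A (f i)"
  shows "D (\<lambda>q. \<Sum>i\<in>I. f i q) = (\<Sum>i\<in>I. D (f i))"
  using assms(2)
proof (induction I rule: infinite_finite_induct)
  case (insert i I)
  then show ?case
    using tangent_vector_add[OF assms(1), of "f i" "\<lambda>q. \<Sum>i\<in>I. f i q"] by (simp add: smooth_fun_sum)
qed (simp_all add: tangent_vector_const[OF assms(1)])

lemma vector_field_tangent: "vector_field A X \<Longrightarrow> X p \<in> tangent_space A p"
  and vector_field_smooth: "vector_field A X \<Longrightarrow> smooth_fun A f \<Longrightarrow> smooth_fun A (\<lambda>p. X p f)"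
  by (auto simp: vector_field_def)

lemma vector_field_zero: "vector_field A (\<lambda>p. 0)"
  unfolding vector_field_def
  using subspace_0[OF subspace_tangent_space] smooth_fun_const[of 0] by simp

lemma vector_field_add:
  "vector_field A X \<Longrightarrow> vector_field A Y \<Longrightarrow> vector_field A (\<lambda>p. X p + Y p)"
  unfolding vector_field_def
  by (auto intro: subspace_add[OF subspace_tangent_space] smooth_fun_add)

lemma vector_field_scale:
  "smooth_fun A f \<Longrightarrow> vector_field A X \<Longrightarrow> vector_field A (\<lambda>p. f p *\<^sub>R X p)"
  unfolding vector_field_def
  by (auto intro: subspace_scale[OF subspace_tangent_space] smooth_fun_mult simp: scaleR_fun_apply)

lemma vector_field_sum:
  "(\<And>i. i \<in> I \<Longrightarrow> vector_field A (X i)) \<Longrightarrow> vector_field A (\<lambda>p. \<Sum>i\<in>I. X i p)"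
  by (induction I rule: infinite_finite_induct) (auto intro: vector_field_zero vector_field_add)

text \<open>The image of the ball is compact, hence closed in the Hausdorff space; its complement and the
  chart domain are open sets on each of which the extension is visibly smooth.\<close>

lemma smooth_fun_extend_chart:
  assumes "(U, \<phi>) \<in> A" "smooth_on (\<phi> ` U) G" "cball x0 R \<subseteq> \<phi> ` U"
    and "\<And>x. x \<in> \<phi> ` U \<Longrightarrow> x \<notin> cball x0 R \<Longrightarrow> G x = 0"
  shows "smooth_fun A (\<lambda>q. if q \<in> U then G (\<phi> q) else 0)"
proof -
  let ?F = "\<lambda>q. if q \<in> U then G (\<phi> q) else 0"
  let ?K = "inv_into U \<phi> ` cball x0 R"
  have "compact ?K"
    by (rule compact_continuous_image[OF continuous_on_subset[OF chart_inv_continuous[OF assms(1)] assms(3)]])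
       simp
  then have K: "closed ?K" by (rule compact_imp_closed)
  have KU: "?K \<subseteq> U" using assms(3) by (auto intro: inv_into_into)
  have "smooth_on (\<psi> ` V) (?F \<circ> inv_into V \<psi>)" if V: "(V, \<psi>) \<in> A" for V \<psi>
  proof (rule smooth_on_local)
    fix x assume "x \<in> \<psi> ` V"
    then obtain q where q: "q \<in> V" "x = \<psi> q" by blast
    show "\<exists>T. open T \<and> x \<in> T \<and> smooth_on T (?F \<circ> inv_into V \<psi>)"
    proof (cases "q \<in> U")
      case True
      have o: "open (\<psi> ` (V \<inter> U))"
        using chart_open_map[OF V, of "V \<inter> U"] chart_open V assms(1) by auto
      have "smooth_on (\<psi> ` (V \<inter> U)) (\<lambda>x. G ((\<phi> \<circ> inv_into V \<psi>) x))"
        by (rule smooth_on_compose[OF o chart_image_open[OF assms(1)] _ assms(2) chart_transition[OF V assms(1)]])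
           (use V in auto)
      then have "smooth_on (\<psi> ` (V \<inter> U)) (?F \<circ> inv_into V \<psi>)"
        by (rule smooth_on_cong[OF o, rotated]) (use V in auto)
      then show ?thesis using o True q by blast
    next
      case False
      have o: "open (\<psi> ` (V - ?K))"
        using chart_open_map[OF V, of "V - ?K"] chart_open[OF V] K by auto
      have "G (\<phi> y) = 0" if "y \<notin> ?K" "y \<in> U" for y
      proof -
        have "\<phi> y \<notin> cball x0 R" using that assms(1) by (metis chart_inv imageI)
        then show ?thesis using assms(4) that by simp
      qed
      then have "smooth_on (\<psi> ` (V - ?K)) (?F \<circ> inv_into V \<psi>)"
        by (intro smooth_on_cong[OF o _ smooth_on_const[OF o, of 0]]) (use V in auto)
      then show ?thesis using o False q KU by blast
    qed
  qed
  then show ?thesis unfolding smooth_fun_def by blast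
qed

text \<open>The coordinate functions and fields of a chart, multiplied by a bump function that is 1 near \<open>p\<close>.\<close>

lemma local_frame_exists:
  obtains N y W where "local_frame A N y W" "p \<in> N"
proof -
  obtain U \<phi> where c: "(U, \<phi>) \<in> A" "p \<in> U" by (rule chart_around)
  obtain R where R: "R > 0" "cball (\<phi> p) R \<subseteq> \<phi> ` U"
    using chart_image_open[OF c(1)] c(2) open_contains_cball by blast
  obtain \<beta> where \<beta>: "smooth_on UNIV \<beta>" "\<And>x. x \<in> ball (\<phi> p) (R/2) \<Longrightarrow> \<beta> x = 1"
      "\<And>x. x \<notin> ball (\<phi> p) R \<Longrightarrow> \<beta> x = (0::real)"
    using smooth_bump[of "R/2" R "\<phi> p"] R(1) by auto
  note oU = chart_image_open[OF c(1)]
  have \<beta>U: "smooth_on (\<phi> ` U) \<beta>" using smooth_on_subset[OF \<beta>(1)] by simp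
  define y where "y = (\<lambda>b q. if q \<in> U then (\<lambda>x. \<beta> x * (x \<bullet> b)) (\<phi> q) else 0)"
  define W where "W = (\<lambda>b q. if q \<in> U then \<beta> (\<phi> q) *\<^sub>R chart_vector A U \<phi> q b else 0)"
  define N where "N = U \<inter> \<phi> -` ball (\<phi> p) (R/2)"
  have y: "smooth_fun A (y b)" for b
    unfolding y_def
    by (rule smooth_fun_extend_chart[OF c(1) _ R(2)])
       (use \<beta>(3) in \<open>auto intro!: smooth_on_mult[OF oU \<beta>U] smooth_on_bounded_linear oU bounded_linear_inner_left\<close>)
  have W: "vector_field A (W b)" for b
    unfolding vector_field_def
  proof (intro conjI allI impI)
    fix q
    show "W b q \<in> tangent_space A q"
      using tangent_space_chart[OF c(1), of q] subspace_tangent_space[of q]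
      by (auto simp: W_def subspace_0 intro: subspace_scale)
  next
    fix f assume f: "smooth_fun A f"
    let ?G = "\<lambda>x. \<beta> x * frechet_derivative (f \<circ> inv_into U \<phi>) (at x) b"
    have "smooth_fun A (\<lambda>q. if q \<in> U then ?G (\<phi> q) else 0)"
      by (rule smooth_fun_extend_chart[OF c(1) smooth_on_mult[OF oU \<beta>U
              smooth_on_derivative[OF smooth_fun_chart[OF f c(1)]]] R(2)])
         (use \<beta>(3) in auto)
    moreover have "(\<lambda>q. if q \<in> U then ?G (\<phi> q) else 0) = (\<lambda>q. W b q f)"
      using f by (auto simp: W_def chart_vector_def scaleR_fun_apply fun_eq_iff)
    ultimately show "smooth_fun A (\<lambda>q. W b q f)" by simp
  qed
  have N: "open N"
  proof -
    have "continuous_on U \<phi>" using chart_homeomorphism[OF c(1)] by (auto simp: homeomorphism_def)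
    then show ?thesis unfolding N_def
      using chart_open[OF c(1)] by (simp add: continuous_open_preimage)
  qed
  have vy: "chart_vector A U \<phi> q v (y b) = v \<bullet> b" if q: "q \<in> N" for q v b
  proof -
    have "((\<lambda>x. x \<bullet> b) has_derivative (\<lambda>v. v \<bullet> b)) (at (\<phi> q))"
      by (auto intro!: derivative_eq_intros)
    then have "((y b \<circ> inv_into U \<phi>) has_derivative (\<lambda>v. v \<bullet> b)) (at (\<phi> q))"
      by (rule has_derivative_transform_within_open[where s = "\<phi> ` N"])
         (use q c \<beta>(2) chart_open_map[OF c(1) N] in \<open>auto simp: N_def y_def\<close>)
    from chart_vector_eqI[OF y this] show ?thesis .
  qed
  have WN: "W b q = chart_vector A U \<phi> q b" if "q \<in> N" for b q
    using that \<beta>(2) by (simp add: W_def N_def)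
  have "D = (\<Sum>b\<in>Basis. D (y b) *\<^sub>R W b q)" if q: "q \<in> N" and D: "D \<in> tangent_space A q" for q D
  proof -
    have qU: "q \<in> U" using q by (simp add: N_def)
    obtain v where v: "D = chart_vector A U \<phi> q v" using D tangent_space_chart[OF c(1) qU] by auto
    interpret linear "chart_vector A U \<phi> q" by (rule linear_chart_vector[OF c(1) qU])
    have "D = chart_vector A U \<phi> q (\<Sum>b\<in>Basis. (v \<bullet> b) *\<^sub>R b)"
      by (simp add: v euclidean_representation)
    also have "\<dots> = (\<Sum>b\<in>Basis. (v \<bullet> b) *\<^sub>R chart_vector A U \<phi> q b)"
      by (simp only: sum scaleR)
    finally have eq: "D = (\<Sum>b\<in>Basis. (v \<bullet> b) *\<^sub>R chart_vector A U \<phi> q b)" .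
    have Dy: "D (y b) = v \<bullet> b" for b by (simp only: v vy[OF q])
    show ?thesis unfolding Dy WN[OF q] by (rule eq)
  qed
  then have "local_frame A N y W"
    unfolding local_frame_def using N y W by (auto simp: WN vy inner_Basis)
  moreover have "p \<in> N" using c R(1) by (simp add: N_def)
  ultimately show thesis by (rule that)
qed

lemma vector_field_extension:
  assumes "D \<in> tangent_space A p"
  obtains X where "vector_field A X" "X p = D"
proof -
  obtain N y W where f: "local_frame A N y W" "p \<in> N" by (rule local_frame_exists)
  have "vector_field A (\<lambda>q. \<Sum>b\<in>Basis. D (y b) *\<^sub>R W b q)"
    using f(1) by (intro vector_field_sum vector_field_scale smooth_fun_const) (auto simp: local_frame_def)
  moreover have "(\<Sum>b\<in>Basis. D (y b) *\<^sub>R W b p) = D"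
    using f assms by (simp add: local_frame_def)
  ultimately show thesis by (rule that)
qed

end

section \<open>Linear algebra of nondegenerate forms\<close>

lemma linear_on_subspace_add: "linear_on_subspace S F \<Longrightarrow> u \<in> S \<Longrightarrow> w \<in> S \<Longrightarrow> F (u + w) = F u + F w"
  and linear_on_subspace_scale: "linear_on_subspace S F \<Longrightarrow> u \<in> S \<Longrightarrow> F (c *\<^sub>R u) = c *\<^sub>R F u"
  by (auto simp: linear_on_subspace_def)

lemma linear_on_subspace_zero: "linear_on_subspace S F \<Longrightarrow> subspace S \<Longrightarrow> F 0 = 0"
  using linear_on_subspace_scale[of S F 0 0] subspace_0 by fastforce

lemma linear_on_subspace_neg: "linear_on_subspace S F \<Longrightarrow> u \<in> S \<Longrightarrow> F (- u) = - F u"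
  using linear_on_subspace_scale[of S F u "-1"] by simp

lemma linear_on_subspace_diff:
  assumes "linear_on_subspace S F" "subspace S" "u \<in> S" "w \<in> S"
  shows "F (u - w) = F u - F w"
  using linear_on_subspace_add[OF assms(1,3) subspace_neg[OF assms(2,4)]]
    linear_on_subspace_neg[OF assms(1,4)] by simp

lemma linear_on_subspace_sum:
  assumes "linear_on_subspace S F" "subspace S" "\<And>i. i \<in> I \<Longrightarrow> u i \<in> S"
  shows "F (\<Sum>i\<in>I. u i) = (\<Sum>i\<in>I. F (u i))"
  using assms(3)
  by (induction I rule: infinite_finite_induct)
     (auto simp: linear_on_subspace_zero[OF assms(1,2)] linear_on_subspace_add[OF assms(1)] subspace_sum[OF assms(2)])

text \<open>Polarization: a symmetric form whose quadratic form vanishes is zero.\<close>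

lemma nondegenerate_non_null_vector:
  fixes b :: "'a::real_vector \<Rightarrow> 'a \<Rightarrow> real"
  assumes V: "subspace V" and lin: "\<And>u. u \<in> V \<Longrightarrow> linear_on_subspace V (b u)"
    and sym: "\<And>u w. u \<in> V \<Longrightarrow> w \<in> V \<Longrightarrow> b u w = b w u"
    and nd: "nondegenerate_on V b" and ne: "u \<in> V" "u \<noteq> 0"
  obtains v where "v \<in> V" "b v v \<noteq> 0"
proof (rule ccontr)
  assume "\<not> thesis"
  with that have null: "b v v = 0" if "v \<in> V" for v using \<open>v \<in> V\<close> by blast
  have "b u w = 0" if w: "w \<in> V" for w
  proof -
    have s: "u + w \<in> V" using V ne w by (simp add: subspace_add)
    have "b (u + w) (u + w) = b u u + b w u + (b u w + b w w)"
      using linear_on_subspace_add[OF lin[OF s] ne(1) w] linear_on_subspace_add[OF lin[OF ne(1)] ne(1) w]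
        linear_on_subspace_add[OF lin[OF w] ne(1) w] sym[OF s ne(1)] sym[OF s w] sym[OF ne(1) w] by simp
    then show ?thesis using null s ne w sym[OF ne(1) w] by simp
  qed
  then show False using nd ne unfolding nondegenerate_on_def by blast
qed

text \<open>A nondegenerate space contains a vector \<open>v\<close> with \<open>b v v \<noteq> 0\<close>. Splitting off its span leaves the
  orthogonal complement of \<open>v\<close> in \<open>V\<close>, which is again nondegenerate and has smaller dimension. Dimension
  is measured by the size of independent subsets, as the type \<open>'a\<close> may be infinite-dimensional, like that of
  all functionals that contains the tangent spaces. The induction is on a bound for these sizes in \<open>V\<close>.\<close>

lemma nondegenerate_projection:
  fixes b :: "'a::real_vector \<Rightarrow> 'a \<Rightarrow> real"
  assumes S: "subspace S" and lin: "\<And>u. u \<in> S \<Longrightarrow> linear_on_subspace S (b u)"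
    and sym: "\<And>u w. u \<in> S \<Longrightarrow> w \<in> S \<Longrightarrow> b u w = b w u"
    and fin: "finite T" "S \<subseteq> span T"
  shows "subspace V \<Longrightarrow> V \<subseteq> S \<Longrightarrow> nondegenerate_on V b \<Longrightarrow> u \<in> S \<Longrightarrow>
    \<exists>w\<in>V. \<forall>x\<in>V. b (u - w) x = 0"
proof -
  have "\<forall>C. C \<subseteq> V \<and> independent C \<longrightarrow> card C \<le> n \<Longrightarrow> subspace V \<Longrightarrow> V \<subseteq> S \<Longrightarrow>
      nondegenerate_on V b \<Longrightarrow> u \<in> S \<Longrightarrow> \<exists>w\<in>V. \<forall>x\<in>V. b (u - w) x = 0" for n V u
  proof (induction n arbitrary: V u)
    case 0
    have "v = 0" if "v \<in> V" for v
    proof (rule ccontr)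
      assume "v \<noteq> 0"
      then have "independent {v}" by simp
      with 0(1) that have "card {v} \<le> 0" by blast
      then show False by simp
    qed
    moreover have "0 \<in> V" using 0 by (simp add: subspace_0)
    ultimately show ?case
      using linear_on_subspace_zero[OF lin[OF 0(5)] S] by (metis diff_zero)
  next
    case (Suc n)
    note V = Suc.prems(2,3)
    have linV: "linear_on_subspace V (b u)" if "u \<in> V" for u
      using lin[of u] that V(2) unfolding linear_on_subspace_def by blast
    show ?case
    proof (cases "\<exists>v\<in>V. v \<noteq> 0")
      case False
      then show ?thesis
        using linear_on_subspace_zero[OF lin[OF Suc.prems(5)] S] subspace_0[OF V(1)] by (metis diff_zero)
    next
      case True
      then obtain v where v: "v \<in> V" "b v v \<noteq> 0"
        using nondegenerate_non_null_vector[OF V(1) linV _ Suc.prems(4)] sym V(2) by (metis subsetD)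
      define V1 where "V1 = {x \<in> V. b v x = 0}"
      have vS: "v \<in> S" using v V by blast
      note bv = lin[OF vS]
      have V1: "subspace V1"
        unfolding V1_def
        by (intro subspaceI)
           (use V(1) linV[OF v(1)] in \<open>auto simp: subspace_0 subspace_add subspace_scale
              linear_on_subspace_zero linear_on_subspace_add linear_on_subspace_scale\<close>)
      have split: "x - (b v x / b v v) *\<^sub>R v \<in> {y \<in> S. b v y = 0}" if "x \<in> S" for x
        using that S vS v(2)
        by (simp add: linear_on_subspace_diff[OF bv S] linear_on_subspace_scale[OF bv] subspace_diff subspace_scale)
      have splitV: "x - (b v x / b v v) *\<^sub>R v \<in> V1" if "x \<in> V" for x
        using split[of x] that V v unfolding V1_def by (auto simp: subspace_diff subspace_scale)
      have decomp: "b y x = (b v x / b v v) * b y v + b y (x - (b v x / b v v) *\<^sub>R v)"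
        if "x \<in> V" "y \<in> S" for x y
      proof -
        have "x \<in> S" using that V by blast
        then show ?thesis
          using linear_on_subspace_diff[OF lin[OF that(2)] S \<open>x \<in> S\<close> subspace_scale[OF S vS]]
            linear_on_subspace_scale[OF lin[OF that(2)] vS] by simp
      qed
      have nd1: "nondegenerate_on V1 b"
        unfolding nondegenerate_on_def
      proof (intro ballI impI)
        fix y assume y: "y \<in> V1" and o: "\<forall>x\<in>V1. b y x = 0"
        have yV: "y \<in> V" "y \<in> S" using y V by (auto simp: V1_def)
        have "b y v = 0" using y sym[OF yV(2) vS] by (simp add: V1_def)
        then have "\<forall>x\<in>V. b y x = 0" using decomp[OF _ yV(2)] o splitV by simp
        then show "y = 0" using Suc.prems(4) yV unfolding nondegenerate_on_def by blast
      qed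
      have card1: "\<forall>C. C \<subseteq> V1 \<and> independent C \<longrightarrow> card C \<le> n"
      proof (intro allI impI)
        fix C assume C: "C \<subseteq> V1 \<and> independent C"
        have "span C \<subseteq> V1" using C V1 by (simp add: span_minimal)
        then have nv: "v \<notin> span C" using v(2) by (auto simp: V1_def)
        then have "independent (insert v C)" using C by (simp add: independent_insertI)
        moreover have "insert v C \<subseteq> V" using C v by (auto simp: V1_def)
        ultimately have "card (insert v C) \<le> Suc n" using Suc.prems(1) by blast
        moreover have "C \<subseteq> span T" using C V fin by (auto simp: V1_def)
        then have "finite C" using independent_span_bound[OF fin(1)] C by blast
        moreover have "v \<notin> C" using nv span_base by blast
        ultimately show "card C \<le> n" by simp
      qed
      let ?u = "u - (b v u / b v v) *\<^sub>R v"
      have u1: "?u \<in> S" "b v ?u = 0" using split[OF Suc.prems(5)] by auto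
      have "V1 \<subseteq> S" using V by (auto simp: V1_def)
      from Suc.IH[OF card1 V1 this nd1 u1(1)]
      obtain w where w: "w \<in> V1" "\<forall>x\<in>V1. b (?u - w) x = 0" by blast
      have wV: "w \<in> V" "w \<in> S" "b v w = 0" using w V by (auto simp: V1_def)
      have uw: "?u - w \<in> S" using u1 wV S by (simp add: subspace_diff)
      have "b (?u - w) v = b v (?u - w)" by (rule sym[OF uw vS])
      also have "\<dots> = 0" using linear_on_subspace_diff[OF bv S u1(1) wV(2)] u1 wV by simp
      finally have "\<forall>x\<in>V. b (?u - w) x = 0"
        using decomp[OF _ uw] w(2) splitV by simp
      moreover have "?u - w = u - ((b v u / b v v) *\<^sub>R v + w)" by simp
      moreover have "(b v u / b v v) *\<^sub>R v + w \<in> V"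
        using V v wV by (simp add: subspace_add subspace_scale)
      ultimately show ?thesis by metis
    qed
  qed
  moreover have "card C \<le> card T" if "C \<subseteq> V" "V \<subseteq> S" "independent C" for C
    using independent_span_bound[OF fin(1) that(3)] that fin(2) by blast
  ultimately show "subspace V \<Longrightarrow> V \<subseteq> S \<Longrightarrow> nondegenerate_on V b \<Longrightarrow> u \<in> S \<Longrightarrow>
    \<exists>w\<in>V. \<forall>x\<in>V. b (u - w) x = 0" by blast
qed

text \<open>A kernel vector \<open>w \<noteq> 0\<close> belongs to some basis, and the image is spanned by the images of the other
  basis vectors.\<close>

lemma full_rank_imp_injective:
  assumes V: "subspace V" "finite T" "V \<subseteq> span T" and F: "linear_on_subspace V F"
    and rank: "rank_on V F = dim V" and w: "w \<in> V" "F w = 0"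
  shows "w = 0"
proof (rule ccontr)
  assume "w \<noteq> 0"
  then have "independent {w}" by simp
  then obtain B where B: "{w} \<subseteq> B" "B \<subseteq> V" "independent B" "V \<subseteq> span B"
    using maximal_independent_subset_extend[of "{w}" V] w by auto
  have "B \<subseteq> span T" using B(2) V(3) by blast
  then have fB: "finite B" using independent_span_bound[OF V(2) B(3)] by blast
  have dV: "dim V = card B" using B by (metis basis_card_eq_dim)
  have "F ` V \<subseteq> span (F ` (B - {w}))"
  proof
    fix y assume "y \<in> F ` V"
    then obtain x where x: "x \<in> V" "y = F x" by blast
    then obtain c where c: "x = (\<Sum>a\<in>B. c a *\<^sub>R a)"
      using B(4) span_finite[OF fB] by auto
    have "y = (\<Sum>a\<in>B. F (c a *\<^sub>R a))"
      unfolding x(2) c using B(2) V(1) by (intro linear_on_subspace_sum[OF F V(1)]) (auto simp: subspace_scale)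
    also have "\<dots> = (\<Sum>a\<in>B. c a *\<^sub>R F a)"
      using B(2) by (intro sum.cong) (auto simp: linear_on_subspace_scale[OF F])
    also have "\<dots> \<in> span (F ` (B - {w}))"
    proof (intro span_sum span_scale)
      fix a assume "a \<in> B"
      then show "F a \<in> span (F ` (B - {w}))"
        by (cases "a = w") (simp_all add: w(2) span_zero span_base)
    qed
    finally show "y \<in> span (F ` (B - {w}))" .
  qed
  then have "dim (F ` V) \<le> card (F ` (B - {w}))"
    using fB by (intro dim_le_card) auto
  also have "\<dots> \<le> card (B - {w})" using fB by (simp add: card_image_le)
  also have "\<dots> < card B" using fB B(1) by (intro psubset_card_mono) auto
  finally show False using rank dV by (simp add: rank_on_def)
qed

section \<open>Geometry of a semi-Riemannian submersion\<close>

locale submersion =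
  fixes A :: "('m::{t2_space,second_countable_topology}, 'e::euclidean_space) atlas"
    and A' :: "('n::{t2_space,second_countable_topology}, 'f::euclidean_space) atlas"
    and g :: "'m tensor02" and g' :: "'n tensor02" and \<pi> :: "'m \<Rightarrow> 'n"
  assumes submersion: "semi_riemannian_submersion A g A' g' \<pi>"
begin

abbreviation "T \<equiv> tangent_space A"
abbreviation "T' \<equiv> tangent_space A'"
abbreviation "d\<pi> \<equiv> pushforward A' \<pi>"
abbreviation "V \<equiv> vertical_space A A' \<pi>"
abbreviation "H \<equiv> horizontal_space A g A' \<pi>"
abbreviation "v \<equiv> vproj A g A' \<pi>"
abbreviation "h \<equiv> hproj A g A' \<pi>"

sublocale M: manifold A
  using submersion by unfold_locales (simp add: semi_riemannian_submersion_def)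

sublocale M': manifold A'
  using submersion by unfold_locales (simp add: semi_riemannian_submersion_def)

lemma
  shows metric_tensor: "tensor_field02 A g"
    and metric_sym: "D \<in> T p \<Longrightarrow> E \<in> T p \<Longrightarrow> g p D E = g p E D"
    and metric_tensor': "tensor_field02 A' g'"
    and smooth_submersion: "smooth_map A A' \<pi>"
    and pushforward_onto: "d\<pi> ` T p = T' (\<pi> p)"
    and isometry_horizontal: "u \<in> H p \<Longrightarrow> w \<in> H p \<Longrightarrow> g' (\<pi> p) (d\<pi> u) (d\<pi> w) = g p u w"
  using submersion by (auto simp: semi_riemannian_submersion_def semi_riemannian_metric_def)

lemma nondegenerate_vertical: "nondegenerate_on (V p) (g p)"
proof -
  have "\<forall>p'. \<exists>r. \<forall>p\<in>\<pi> -` {p'}. nondegenerate_on (V p) (g p) \<and> form_index (V p) (g p) = r"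
    using submersion by (simp add: semi_riemannian_submersion_def)
  then show ?thesis by (metis vimage_singleton_eq)
qed

lemma pushforward_tangent: "D \<in> T p \<Longrightarrow> d\<pi> D \<in> T' (\<pi> p)"
  using pushforward_onto by blast

lemma metric_linear: "D \<in> T p \<Longrightarrow> linear_on_subspace (T p) (g p D)"
  and metric_linear_left: "D \<in> T p \<Longrightarrow> linear_on_subspace (T p) (\<lambda>E. g p E D)"
  using metric_tensor by (auto simp: tensor_field02_def)

lemma metric_linear': "D \<in> T' r \<Longrightarrow> linear_on_subspace (T' r) (g' r D)"
  and metric_linear_left': "D \<in> T' r \<Longrightarrow> linear_on_subspace (T' r) (\<lambda>E. g' r E D)"
  using metric_tensor' by (auto simp: tensor_field02_def)

lemmas metric_simps =
  linear_on_subspace_add[OF metric_linear] linear_on_subspace_add[OF metric_linear_left]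
  linear_on_subspace_diff[OF metric_linear M.subspace_tangent_space]
  linear_on_subspace_diff[OF metric_linear_left M.subspace_tangent_space]
  linear_on_subspace_zero[OF metric_linear M.subspace_tangent_space]
  linear_on_subspace_zero[OF metric_linear_left M.subspace_tangent_space]

lemma metric_smooth: "vector_field A X \<Longrightarrow> vector_field A Y \<Longrightarrow> smooth_fun A (\<lambda>q. g q (X q) (Y q))"
  and metric_smooth': "vector_field A' X' \<Longrightarrow> vector_field A' Y' \<Longrightarrow> smooth_fun A' (\<lambda>q. g' q (X' q) (Y' q))"
  using metric_tensor metric_tensor' by (auto simp: tensor_field02_def)

lemma smooth_fun_pullback:
  assumes f: "smooth_fun A' f"
  shows "smooth_fun A (\<lambda>q. f (\<pi> q))"
proof -
  have cont: "continuous_on UNIV \<pi>" using smooth_submersion by (simp add: smooth_map_def)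
  have "smooth_on (\<phi> ` U) ((\<lambda>q. f (\<pi> q)) \<circ> inv_into U \<phi>)" if c: "(U, \<phi>) \<in> A" for U \<phi>
  proof (rule smooth_on_local)
    fix x assume "x \<in> \<phi> ` U"
    then obtain q where q: "q \<in> U" "x = \<phi> q" by blast
    obtain V \<psi> where c': "(V, \<psi>) \<in> A'" "\<pi> q \<in> V" by (rule M'.chart_around)
    let ?T = "\<phi> ` (U \<inter> \<pi> -` V)"
    have "open (\<pi> -` V)" using cont M'.chart_open[OF c'(1)] by (simp add: continuous_on_open_vimage)
    then have o: "open ?T" using M.chart_open[OF c] by (intro M.chart_open_map[OF c]) auto
    have "smooth_on ?T (\<psi> \<circ> \<pi> \<circ> inv_into U \<phi>)"
      using smooth_submersion c c'(1) unfolding smooth_map_def by fast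
    then have "smooth_on ?T (\<lambda>x. (f \<circ> inv_into V \<psi>) ((\<psi> \<circ> \<pi> \<circ> inv_into U \<phi>) x))"
      by (rule smooth_on_compose[OF o M'.chart_image_open[OF c'(1)] _ M'.smooth_fun_chart[OF f c'(1)], rotated])
         (use c in auto)
    then have "smooth_on ?T ((\<lambda>q. f (\<pi> q)) \<circ> inv_into U \<phi>)"
      by (rule smooth_on_cong[OF o, rotated]) (use c c' in auto)
    then show "\<exists>T. open T \<and> x \<in> T \<and> smooth_on T ((\<lambda>q. f (\<pi> q)) \<circ> inv_into U \<phi>)"
      using o q c' by blast
  qed
  then show ?thesis unfolding smooth_fun_def by blast
qed

lemma pushforward_apply: "smooth_fun A' f \<Longrightarrow> d\<pi> D f = D (\<lambda>q. f (\<pi> q))"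
  by (simp add: pushforward_def o_def)

lemma pushforward_add: "d\<pi> (D + E) = d\<pi> D + d\<pi> E"
  and pushforward_scale: "d\<pi> (c *\<^sub>R D) = c *\<^sub>R d\<pi> D"
  and pushforward_zero: "d\<pi> 0 = 0"
  by (auto simp: pushforward_def fun_eq_iff scaleR_fun_apply)

lemma vertical_iff: "u \<in> V p \<longleftrightarrow> u \<in> T p \<and> (\<forall>f. smooth_fun A' f \<longrightarrow> u (\<lambda>q. f (\<pi> q)) = 0)"
  by (auto simp: vertical_space_def pushforward_def fun_eq_iff o_def)

lemma vertical_tangent: "u \<in> V p \<Longrightarrow> u \<in> T p"
  and horizontal_tangent: "u \<in> H p \<Longrightarrow> u \<in> T p"
  by (auto simp: vertical_space_def horizontal_space_def)

lemma subspace_vertical: "subspace (V p)"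
  using M.subspace_tangent_space[of p]
  by (auto simp: subspace_def vertical_space_def pushforward_add pushforward_scale pushforward_zero)

lemma subspace_horizontal: "subspace (H p)"
proof -
  have "w \<in> T p" if "w \<in> V p" for w using that vertical_tangent by blast
  then show ?thesis
    using M.subspace_tangent_space[of p]
    by (auto simp: subspace_def horizontal_space_def metric_simps linear_on_subspace_scale[OF metric_linear_left])
qed

lemma vertical_horizontal_zero: "u \<in> V p \<Longrightarrow> u \<in> H p \<Longrightarrow> u = 0"
  using nondegenerate_vertical[of p] by (auto simp: nondegenerate_on_def horizontal_space_def)

lemma vproj_eqI:
  assumes "w \<in> V p" "u - w \<in> H p"
  shows "v p u = w"
  unfolding vproj_def
proof (rule the_equality)
  fix w' assume w': "w' \<in> V p \<and> u - w' \<in> H p"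
  then have "w' - w \<in> V p" using assms subspace_vertical by (simp add: subspace_diff)
  moreover have "(u - w) - (u - w') \<in> H p" using assms w' subspace_horizontal subspace_diff by blast
  ultimately show "w' = w" using vertical_horizontal_zero[of "w' - w"] by simp
qed (use assms in blast)

lemma
  assumes "u \<in> T p"
  shows vproj_vertical: "v p u \<in> V p" and hproj_horizontal: "h p u \<in> H p"
proof -
  obtain B where B: "finite B" "T p \<subseteq> span B" by (rule M.tangent_space_finite_dim)
  have "V p \<subseteq> T p" by (auto simp: vertical_space_def)
  from nondegenerate_projection[OF M.subspace_tangent_space metric_linear metric_sym B
      subspace_vertical this nondegenerate_vertical assms]
  obtain w where w: "w \<in> V p" "\<forall>x\<in>V p. g p (u - w) x = 0" by blast
  then have "u - w \<in> H p"
    using assms vertical_tangent[OF w(1)] M.subspace_tangent_space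
    by (auto simp: horizontal_space_def subspace_diff)
  with w(1) vproj_eqI[OF w(1) this] show "v p u \<in> V p" "h p u \<in> H p" by (auto simp: hproj_def)
qed

lemma vproj_of_vertical: "u \<in> V p \<Longrightarrow> v p u = u"
  by (rule vproj_eqI) (simp_all add: subspace_0[OF subspace_horizontal])

lemma vproj_of_horizontal: "u \<in> H p \<Longrightarrow> v p u = 0"
  by (rule vproj_eqI) (simp_all add: subspace_0[OF subspace_vertical])

text \<open>The vertical part of \<open>u\<close> is that of \<open>w\<close> increased by \<open>u - w\<close>. All later comparisons of
  horizontal parts are made modulo vertical vectors in this way.\<close>

lemma hproj_eqI:
  assumes "u \<in> T p" "w \<in> T p" "u - w \<in> V p"
  shows "h p u = h p w"
proof -
  have e: "u - (v p w + (u - w)) = h p w" by (simp add: hproj_def)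
  have "v p u = v p w + (u - w)"
    by (rule vproj_eqI, rule subspace_add[OF subspace_vertical vproj_vertical[OF assms(2)] assms(3)],
        unfold e, rule hproj_horizontal[OF assms(2)])
  then show ?thesis by (simp add: hproj_def)
qed

text \<open>One horizontal argument suffices for \<open>g\<close> to be the pullback of \<open>g'\<close>: the vertical part of the other
  argument is orthogonal to it and is killed by \<open>d\<pi>\<close>.\<close>

lemma metric_horizontal_pushforward:
  assumes "e \<in> T p" "z \<in> H p"
  shows "g p e z = g' (\<pi> p) (d\<pi> e) (d\<pi> z)" "g p z e = g' (\<pi> p) (d\<pi> z) (d\<pi> e)"
proof -
  note ve = vproj_vertical[OF assms(1)] and he = hproj_horizontal[OF assms(1)]
  have e: "e = v p e + h p e" by (simp add: hproj_def)
  have "d\<pi> (v p e) = 0" using ve by (simp add: vertical_space_def)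
  then have de: "d\<pi> e = d\<pi> (h p e)" by (subst e) (simp add: pushforward_add)
  have zv: "g p z (v p e) = 0" using assms(2) ve by (simp add: horizontal_space_def)
  have t: "v p e \<in> T p" "h p e \<in> T p" "z \<in> T p"
    using ve he assms(2) vertical_tangent horizontal_tangent by auto
  have "g p z e = g p z (h p e)"
    by (subst e) (simp add: linear_on_subspace_add[OF metric_linear[OF t(3)] t(1,2)] zv)
  then show "g p z e = g' (\<pi> p) (d\<pi> z) (d\<pi> e)" using isometry_horizontal[OF assms(2) he] de by simp
  have "g p e z = g p (h p e) z"
    using \<open>g p z e = g p z (h p e)\<close> metric_sym[OF assms(1) t(3)] metric_sym[OF t(2,3)] by simp
  then show "g p e z = g' (\<pi> p) (d\<pi> e) (d\<pi> z)" using isometry_horizontal[OF he assms(2)] de by simp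
qed

lemma pullback_frame_open:
  assumes "local_frame A' N y W" shows "open (\<pi> -` N)"
  using assms smooth_submersion
  by (simp add: local_frame_def smooth_map_def continuous_on_open_vimage)

lemma pushforward_frame:
  assumes "local_frame A' N y W" "D \<in> T q" "\<pi> q \<in> N"
  shows "d\<pi> D = (\<Sum>b\<in>Basis. D (\<lambda>q. y b (\<pi> q)) *\<^sub>R W b (\<pi> q))"
proof -
  have "d\<pi> D = (\<Sum>b\<in>Basis. d\<pi> D (y b) *\<^sub>R W b (\<pi> q))"
    using assms pushforward_tangent unfolding local_frame_def by blast
  also have "\<dots> = (\<Sum>b\<in>Basis. D (\<lambda>q. y b (\<pi> q)) *\<^sub>R W b (\<pi> q))"
    using assms(1) by (intro sum.cong) (auto simp: local_frame_def pushforward_apply)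
  finally show ?thesis .
qed

lemma frame_smooth: "local_frame A' N y W \<Longrightarrow> b \<in> Basis \<Longrightarrow> smooth_fun A (\<lambda>q. y b (\<pi> q))"
  and frame_field: "local_frame A' N y W \<Longrightarrow> b \<in> Basis \<Longrightarrow> vector_field A' (W b)"
  by (auto simp: local_frame_def intro: smooth_fun_pullback)

lemma metric_pushforward_expand:
  assumes fr: "local_frame A' N y W" "\<pi> q \<in> N" and D: "D \<in> T q" and E: "E \<in> T q"
  shows "g' (\<pi> q) (d\<pi> D) (d\<pi> E) =
    (\<Sum>b\<in>Basis. \<Sum>c\<in>Basis. D (\<lambda>q. y b (\<pi> q)) * E (\<lambda>q. y c (\<pi> q)) * g' (\<pi> q) (W b (\<pi> q)) (W c (\<pi> q)))"
proof -
  note T' = M'.subspace_tangent_space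
  have W: "W b (\<pi> q) \<in> T' (\<pi> q)" if "b \<in> Basis" for b
    using frame_field[OF fr(1) that] by (rule M'.vector_field_tangent)
  have "g' (\<pi> q) (d\<pi> D) (d\<pi> E) = (\<Sum>b\<in>Basis. D (\<lambda>q. y b (\<pi> q)) * g' (\<pi> q) (W b (\<pi> q)) (d\<pi> E))"
    unfolding pushforward_frame[OF fr(1) D fr(2)]
    by (subst linear_on_subspace_sum[OF metric_linear_left'[OF pushforward_tangent[OF E]] T'])
       (auto simp: subspace_scale[OF T'] W linear_on_subspace_scale[OF metric_linear_left'[OF pushforward_tangent[OF E]]])
  also have "\<dots> = (\<Sum>b\<in>Basis. D (\<lambda>q. y b (\<pi> q)) *
      (\<Sum>c\<in>Basis. E (\<lambda>q. y c (\<pi> q)) * g' (\<pi> q) (W b (\<pi> q)) (W c (\<pi> q))))"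
  proof (intro sum.cong refl arg_cong2[where f = "(*)"])
    fix b :: 'f assume b: "b \<in> Basis"
    show "g' (\<pi> q) (W b (\<pi> q)) (d\<pi> E) = (\<Sum>c\<in>Basis. E (\<lambda>q. y c (\<pi> q)) * g' (\<pi> q) (W b (\<pi> q)) (W c (\<pi> q)))"
      unfolding pushforward_frame[OF fr(1) E fr(2)]
      by (subst linear_on_subspace_sum[OF metric_linear'[OF W[OF b]] T'])
         (auto simp: subspace_scale[OF T'] W linear_on_subspace_scale[OF metric_linear'[OF W[OF b]]])
  qed
  finally show ?thesis by (simp add: sum_distrib_left mult.assoc)
qed

text \<open>The product rule in a frame of the base. Its third summand differentiates functions pulled back
  from the base, so it vanishes for vertical \<open>D\<close>.\<close>

lemma derivative_of_horizontal_product: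
  assumes fr: "local_frame A' N y W" "\<pi> p \<in> N" and D: "D \<in> T p"
    and X: "vector_field A X" and Z: "horizontal_field A g A' \<pi> Z"
  shows "D (\<lambda>q. g q (X q) (Z q)) = (\<Sum>b\<in>Basis. \<Sum>c\<in>Basis.
      D (\<lambda>q. X q (\<lambda>q. y b (\<pi> q))) * Z p (\<lambda>q. y c (\<pi> q)) * g' (\<pi> p) (W b (\<pi> p)) (W c (\<pi> p))
    + X p (\<lambda>q. y b (\<pi> q)) * D (\<lambda>q. Z q (\<lambda>q. y c (\<pi> q))) * g' (\<pi> p) (W b (\<pi> p)) (W c (\<pi> p))
    + X p (\<lambda>q. y b (\<pi> q)) * Z p (\<lambda>q. y c (\<pi> q)) * D (\<lambda>q. g' (\<pi> q) (W b (\<pi> q)) (W c (\<pi> q))))"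
    (is "_ = (\<Sum>b\<in>_. \<Sum>c\<in>_. ?R b c)")
proof -
  have Zf: "vector_field A Z" "\<And>q. Z q \<in> H q" using Z by (auto simp: horizontal_field_def)
  let ?x = "\<lambda>b q. X q (\<lambda>q. y b (\<pi> q))" and ?z = "\<lambda>c q. Z q (\<lambda>q. y c (\<pi> q))"
    and ?G = "\<lambda>b c q. g' (\<pi> q) (W b (\<pi> q)) (W c (\<pi> q))"
  have sx: "smooth_fun A (?x b)" and sz: "smooth_fun A (?z b)" if "b \<in> Basis" for b
    using M.vector_field_smooth X Zf(1) frame_smooth[OF fr(1) that] by auto
  have sG: "smooth_fun A (?G b c)" if "b \<in> Basis" "c \<in> Basis" for b c
    using smooth_fun_pullback[OF metric_smooth'[OF frame_field[OF fr(1) that(1)] frame_field[OF fr(1) that(2)]]] .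
  have s: "smooth_fun A (\<lambda>q. ?x b q * ?z c q * ?G b c q)" if "b \<in> Basis" "c \<in> Basis" for b c
    using that sx sz sG by (intro M.smooth_fun_mult)
  have "D (\<lambda>q. g q (X q) (Z q)) = D (\<lambda>q. \<Sum>b\<in>Basis. \<Sum>c\<in>Basis. ?x b q * ?z c q * ?G b c q)"
  proof (rule M.tangent_vector_local[OF D _ _ pullback_frame_open[OF fr(1)]])
    fix q assume "q \<in> \<pi> -` N"
    then show "g q (X q) (Z q) = (\<Sum>b\<in>Basis. \<Sum>c\<in>Basis. ?x b q * ?z c q * ?G b c q)"
      using metric_horizontal_pushforward(1)[OF M.vector_field_tangent[OF X] Zf(2)]
        metric_pushforward_expand[OF fr(1) _ M.vector_field_tangent[OF X] M.vector_field_tangent[OF Zf(1)]]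
      by simp
  qed (use fr s in \<open>auto intro!: metric_smooth X Zf M.smooth_fun_sum\<close>)
  also have "\<dots> = (\<Sum>b\<in>Basis. \<Sum>c\<in>Basis. D (\<lambda>q. ?x b q * ?z c q * ?G b c q))"
    using s by (simp add: M.tangent_vector_sum[OF D] M.smooth_fun_sum)
  also have "\<dots> = (\<Sum>b\<in>Basis. \<Sum>c\<in>Basis. ?R b c)"
    using sx sz sG
    by (intro sum.cong refl)
       (simp add: M.tangent_vector_mult[OF D] M.smooth_fun_mult algebra_simps)
  finally show ?thesis .
qed

text \<open>The components of \<open>d\<pi> (U q)\<close> vanish at \<open>p\<close> together with their first derivatives. Near \<open>p\<close>
  the field may leave the vertical spaces.\<close>

definition vertical_to_first_order :: "'m \<Rightarrow> 'm vfield \<Rightarrow> bool" where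
  "vertical_to_first_order p U \<longleftrightarrow> vector_field A U \<and> U p \<in> V p \<and>
     (\<forall>f. smooth_fun A' f \<longrightarrow> (\<forall>D\<in>T p. D (\<lambda>q. U q (\<lambda>q. f (\<pi> q))) = 0))"

lemma first_orderD:
  assumes "vertical_to_first_order p U" "smooth_fun A' f"
  shows "U p (\<lambda>q. f (\<pi> q)) = 0" "D \<in> T p \<Longrightarrow> D (\<lambda>q. U q (\<lambda>q. f (\<pi> q))) = 0"
  using assms by (auto simp: vertical_to_first_order_def vertical_iff)

text \<open>Near \<open>p\<close> the product is bilinear in the components of \<open>d\<pi> U\<close> and \<open>d\<pi> Z\<close>, and the former vanish to first order.\<close>

lemma derivative_vertical_horizontal:
  assumes U: "vertical_to_first_order p U" and D: "D \<in> T p" and Z: "horizontal_field A g A' \<pi> Z"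
  shows "D (\<lambda>q. g q (U q) (Z q)) = 0"
proof -
  obtain N y W where fr: "local_frame A' N y W" "\<pi> p \<in> N" by (rule M'.local_frame_exists)
  have "vector_field A U" using U by (simp add: vertical_to_first_order_def)
  from derivative_of_horizontal_product[OF fr D this Z] show ?thesis
    using fr(1) by (auto simp: local_frame_def first_orderD(1)[OF U] first_orderD(2)[OF U _ D] intro!: sum.neutral)
qed

lemma bracket_pushforward:
  assumes "vertical_to_first_order p U" "vector_field A X" "smooth_fun A' f"
  shows "lie_bracket U X p (\<lambda>q. f (\<pi> q)) = U p (\<lambda>q. X q (\<lambda>q. f (\<pi> q)))"
  using first_orderD(2)[OF assms(1,3) M.vector_field_tangent[OF assms(2)]] by (simp add: lie_bracket_def)

text \<open>The Lie derivative of \<open>g\<close> along \<open>U\<close> vanishes on horizontal fields: \<open>U\<close> differentiates the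
  components of \<open>d\<pi> X\<close> and \<open>d\<pi> Z\<close>, but not the coefficients of \<open>g'\<close>, and the derived components are
  those of \<open>d\<pi> [U, X]\<close> and \<open>d\<pi> [U, Z]\<close>.\<close>

lemma derivative_horizontal_horizontal:
  assumes U: "vertical_to_first_order p U"
    and X: "horizontal_field A g A' \<pi> X" and Z: "horizontal_field A g A' \<pi> Z"
    and t: "lie_bracket U X p \<in> T p" "lie_bracket U Z p \<in> T p"
  shows "U p (\<lambda>q. g q (X q) (Z q)) = g p (lie_bracket U X p) (Z p) + g p (X p) (lie_bracket U Z p)"
proof -
  obtain N y W where fr: "local_frame A' N y W" "\<pi> p \<in> N" by (rule M'.local_frame_exists)
  have Xf: "vector_field A X" "X p \<in> H p" and Zf: "vector_field A Z" "Z p \<in> H p"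
    using X Z by (auto simp: horizontal_field_def)
  have Uv: "U p \<in> V p" using U by (simp add: vertical_to_first_order_def)
  have y: "smooth_fun A' (y b)" if "b \<in> Basis" for b using fr(1) that by (simp add: local_frame_def)
  have G: "U p (\<lambda>q. g' (\<pi> q) (W b (\<pi> q)) (W c (\<pi> q))) = 0" if "b \<in> Basis" "c \<in> Basis" for b c
    using metric_smooth'[OF frame_field[OF fr(1) that(1)] frame_field[OF fr(1) that(2)]] Uv
    unfolding vertical_iff by blast
  show ?thesis
    unfolding derivative_of_horizontal_product[OF fr vertical_tangent[OF Uv] Xf(1) Z]
      metric_horizontal_pushforward(1)[OF t(1) Zf(2)] metric_horizontal_pushforward(2)[OF t(2) Xf(2)]
      metric_pushforward_expand[OF fr t(1) horizontal_tangent[OF Zf(2)]]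
      metric_pushforward_expand[OF fr horizontal_tangent[OF Xf(2)] t(2)]
      sum.distrib[symmetric]
    by (intro sum.cong refl)
       (simp add: G y bracket_pushforward[OF U Xf(1)] bracket_pushforward[OF U Zf(1)])
qed

text \<open>For tensors \<open>P\<close> and \<open>P'\<close> related by \<open>\<pi>\<close>, the derivative of a pulled back function along \<open>P X\<close> is a
  combination of the components of \<open>d\<pi> X\<close> with coefficients pulled back from the base. This lemma and the next
  are also used with the identity tensors, where they express derivatives along \<open>X\<close>
  itself.\<close>

lemma component_of_tensor_image:
  assumes fr: "local_frame A' N y W" "\<pi> q \<in> N"
    and P': "tensor_field11 A' P'"
    and com: "\<forall>p. \<forall>u\<in>T p. d\<pi> (P p u) = P' (\<pi> p) (d\<pi> u)"
    and E: "E \<in> T q" and f: "smooth_fun A' f"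
  shows "P q E (\<lambda>q. f (\<pi> q)) = (\<Sum>b\<in>Basis. E (\<lambda>q. y b (\<pi> q)) * P' (\<pi> q) (W b (\<pi> q)) f)"
proof -
  have W: "W b r \<in> T' r" if "b \<in> Basis" for b r
    using frame_field[OF fr(1) that] by (rule M'.vector_field_tangent)
  have lin: "linear_on_subspace (T' r) (P' r)" for r using P' by (simp add: tensor_field11_def)
  have "P q E (\<lambda>q. f (\<pi> q)) = P' (\<pi> q) (d\<pi> E) f"
    using com E pushforward_apply[OF f, of "P q E"] by simp
  also have "P' (\<pi> q) (d\<pi> E) = (\<Sum>b\<in>Basis. E (\<lambda>q. y b (\<pi> q)) *\<^sub>R P' (\<pi> q) (W b (\<pi> q)))"
    unfolding pushforward_frame[OF fr(1) E fr(2)]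
    by (subst linear_on_subspace_sum[OF lin M'.subspace_tangent_space])
       (auto simp: subspace_scale[OF M'.subspace_tangent_space] W linear_on_subspace_scale[OF lin])
  finally show ?thesis by (simp add: sum_fun_apply scaleR_fun_apply)
qed

lemma derivative_of_tensor_component:
  assumes fr: "local_frame A' N y W" "\<pi> p \<in> N" and D: "D \<in> T p"
    and P: "tensor_field11 A P" and P': "tensor_field11 A' P'"
    and com: "\<forall>p. \<forall>u\<in>T p. d\<pi> (P p u) = P' (\<pi> p) (d\<pi> u)"
    and X: "vector_field A X" and f: "smooth_fun A' f"
  shows "D (\<lambda>q. P q (X q) (\<lambda>q. f (\<pi> q))) = (\<Sum>b\<in>Basis.
      D (\<lambda>q. X q (\<lambda>q. y b (\<pi> q))) * P' (\<pi> p) (W b (\<pi> p)) f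
    + X p (\<lambda>q. y b (\<pi> q)) * D (\<lambda>q. P' (\<pi> q) (W b (\<pi> q)) f))"
proof -
  let ?x = "\<lambda>b q. X q (\<lambda>q. y b (\<pi> q))" and ?c = "\<lambda>b q. P' (\<pi> q) (W b (\<pi> q)) f"
  have PX: "vector_field A (\<lambda>q. P q (X q))" using P X by (simp add: tensor_field11_def)
  have sx: "smooth_fun A (?x b)" if "b \<in> Basis" for b
    using M.vector_field_smooth[OF X frame_smooth[OF fr(1) that]] .
  have sc: "smooth_fun A (?c b)" if "b \<in> Basis" for b
  proof -
    have "vector_field A' (\<lambda>r. P' r (W b r))" using P' frame_field[OF fr(1) that] by (simp add: tensor_field11_def)
    from smooth_fun_pullback[OF M'.vector_field_smooth[OF this f]] show ?thesis .
  qed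
  have "D (\<lambda>q. P q (X q) (\<lambda>q. f (\<pi> q))) = D (\<lambda>q. \<Sum>b\<in>Basis. ?x b q * ?c b q)"
    by (rule M.tangent_vector_local[OF D _ _ pullback_frame_open[OF fr(1)]])
       (use fr sx sc in \<open>auto intro!: M.smooth_fun_sum M.smooth_fun_mult
          component_of_tensor_image[OF fr(1) _ P' com M.vector_field_tangent[OF X] f]
          M.vector_field_smooth[OF PX smooth_fun_pullback[OF f]]\<close>)
  also have "\<dots> = (\<Sum>b\<in>Basis. D (\<lambda>q. ?x b q * ?c b q))"
    using sx sc by (simp add: M.tangent_vector_sum[OF D] M.smooth_fun_mult)
  also have "\<dots> = (\<Sum>b\<in>Basis. D (?x b) * ?c b p + ?x b p * D (?c b))"
    using sx sc by (simp add: M.tangent_vector_mult[OF D])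
  finally show ?thesis .
qed

text \<open>Products of the components of \<open>d\<pi> U\<close>, which vanish to first order, with smooth coefficients
  vanish to first order as well.\<close>

lemma first_order_tensor:
  assumes P: "tensor_field11 A P" and P': "tensor_field11 A' P'"
    and com: "\<forall>p. \<forall>u\<in>T p. d\<pi> (P p u) = P' (\<pi> p) (d\<pi> u)"
    and U: "vector_field A U" and fr: "local_frame A' N y W" "\<pi> p \<in> N"
    and 0: "\<And>b. b \<in> Basis \<Longrightarrow> U p (\<lambda>q. y b (\<pi> q)) = 0"
      "\<And>b D. b \<in> Basis \<Longrightarrow> D \<in> T p \<Longrightarrow> D (\<lambda>q. U q (\<lambda>q. y b (\<pi> q))) = 0"
  shows "vertical_to_first_order p (\<lambda>q. P q (U q))"
proof -
  have PU: "vector_field A (\<lambda>q. P q (U q))" using P U by (simp add: tensor_field11_def)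
  show ?thesis
    unfolding vertical_to_first_order_def vertical_iff
  proof (intro conjI allI impI ballI PU M.vector_field_tangent[OF PU])
    fix f assume f: "smooth_fun A' f"
    show "P p (U p) (\<lambda>q. f (\<pi> q)) = 0"
      unfolding component_of_tensor_image[OF fr P' com M.vector_field_tangent[OF U] f] using 0 by (simp add: sum.neutral)
    show "D (\<lambda>q. P q (U q) (\<lambda>q. f (\<pi> q))) = 0" if "D \<in> T p" for D
      unfolding derivative_of_tensor_component[OF fr that P P' com U f] using 0 that by (simp add: sum.neutral)
  qed
qed

text \<open>Take any extension \<open>E\<close> of \<open>u\<close> and fields \<open>F b\<close> that project at \<open>p\<close> to the frame vectors. Then
  \<open>U = E - (\<Sum>b. E (y b \<circ> \<pi>) F b)\<close> has components \<open>e c - (\<Sum>b. e b * m b c)\<close>, where the \<open>e b\<close>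
  vanish at \<open>p\<close> and the matrix \<open>m\<close> is the identity there. The first derivatives at \<open>p\<close> cancel, whatever
  the derivatives of \<open>m\<close> are.\<close>

lemma first_order_extension:
  assumes u: "u \<in> V p"
  obtains U where "vertical_to_first_order p U" "U p = u"
proof -
  obtain N y W where fr: "local_frame A' N y W" "\<pi> p \<in> N" by (rule M'.local_frame_exists)
  have y: "smooth_fun A' (y b)" if "b \<in> Basis" for b using fr(1) that by (simp add: local_frame_def)
  obtain E where E: "vector_field A E" "E p = u"
    using M.vector_field_extension[OF vertical_tangent[OF u]] by blast
  have "\<forall>b\<in>Basis. \<exists>F. vector_field A F \<and> d\<pi> (F p) = W b (\<pi> p)"
  proof
    fix b :: 'f assume "b \<in> Basis"
    then have "W b (\<pi> p) \<in> d\<pi> ` T p"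
      using M'.vector_field_tangent[OF frame_field[OF fr(1)]] by (simp add: pushforward_onto)
    then show "\<exists>F. vector_field A F \<and> d\<pi> (F p) = W b (\<pi> p)"
      using M.vector_field_extension by (metis imageE)
  qed
  then obtain F where F: "\<And>b. b \<in> Basis \<Longrightarrow> vector_field A (F b)"
      "\<And>b. b \<in> Basis \<Longrightarrow> d\<pi> (F b p) = W b (\<pi> p)" by metis
  let ?e = "\<lambda>b q. E q (\<lambda>q. y b (\<pi> q))" and ?m = "\<lambda>b c q. F b q (\<lambda>q. y c (\<pi> q))"
  define U where "U = (\<lambda>q. E q + (\<Sum>b\<in>Basis. (-1 * ?e b q) *\<^sub>R F b q))"
  have se: "smooth_fun A (\<lambda>q. -1 * ?e b q)" "smooth_fun A (?e b)" if "b \<in> Basis" for b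
    using M.vector_field_smooth[OF E(1) frame_smooth[OF fr(1) that]]
      M.smooth_fun_mult[OF M.smooth_fun_const]
    by blast+
  have sm: "smooth_fun A (?m b c)" if "b \<in> Basis" "c \<in> Basis" for b c
    using M.vector_field_smooth[OF F(1)[OF that(1)] frame_smooth[OF fr(1) that(2)]] .
  have Uf: "vector_field A U"
    unfolding U_def by (intro M.vector_field_add E M.vector_field_sum M.vector_field_scale se F)
  have e0: "?e b p = 0" if "b \<in> Basis" for b using u y[OF that] by (simp add: E(2) vertical_iff)
  have Up: "U p = u" unfolding U_def using e0 by (simp add: E(2))
  have m: "?m b c p = (if b = c then 1 else 0)" if "b \<in> Basis" "c \<in> Basis" for b c
    using F(2)[OF that(1)] pushforward_apply[OF y[OF that(2)], of "F b p"] fr that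
    by (simp add: local_frame_def)
  have Uc: "U q (\<lambda>q. y c (\<pi> q)) = ?e c q + (\<Sum>b\<in>Basis. (-1 * ?e b q) * ?m b c q)" for c q
    by (simp add: U_def sum_fun_apply scaleR_fun_apply)
  have "D (\<lambda>q. U q (\<lambda>q. y c (\<pi> q))) = 0" if c: "c \<in> Basis" and D: "D \<in> T p" for c D
  proof -
    have neg: "D (\<lambda>q. -1 * ?e b q) = - D (?e b)" if "b \<in> Basis" for b
      using M.tangent_vector_mult[OF D M.smooth_fun_const se(2)[OF that], of "-1"]
        M.tangent_vector_const[OF D] by simp
    have "D (\<lambda>q. U q (\<lambda>q. y c (\<pi> q))) = D (?e c) + (\<Sum>b\<in>Basis. D (\<lambda>q. (-1 * ?e b q) * ?m b c q))"
      unfolding Uc using c se sm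
      by (simp only: M.tangent_vector_add[OF D] M.tangent_vector_sum[OF D] M.smooth_fun_sum M.smooth_fun_mult)
    also have "\<dots> = D (?e c) + (\<Sum>b\<in>Basis. - D (?e b) * ?m b c p)"
    proof (intro arg_cong2[where f = "(+)"] refl sum.cong)
      fix b :: 'f assume b: "b \<in> Basis"
      show "D (\<lambda>q. (-1 * ?e b q) * ?m b c q) = - D (?e b) * ?m b c p"
        using M.tangent_vector_mult[OF D se(1)[OF b] sm[OF b c]] unfolding neg[OF b] e0[OF b] by simp
    qed
    also have "(\<Sum>b\<in>Basis. - D (?e b) * ?m b c p) = (\<Sum>b\<in>Basis. if b = c then - D (?e b) else 0)"
      using c by (intro sum.cong) (auto simp: m)
    finally show ?thesis using c by simp
  qed
  moreover have "U p (\<lambda>q. y b (\<pi> q)) = 0" if "b \<in> Basis" for b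
    using e0[OF that] by (simp add: Up E(2))
  moreover have "tensor_field11 A (\<lambda>q u. u)" "tensor_field11 A' (\<lambda>q u. u)"
    by (auto simp: tensor_field11_def linear_on_subspace_def)
  \<comment> \<open>with identity tensors, vanishing of the frame components extends to all pulled back functions\<close>
  ultimately have "vertical_to_first_order p U"
    using first_order_tensor[of "\<lambda>q u. u" "\<lambda>q u. u", OF _ _ _ Uf fr] by simp
  with Up show thesis using that by blast
qed

end

section \<open>Para-Kaehler-like statistical submersions\<close>

locale para_kaehler_submersion = submersion A A' g g' \<pi>
  for A :: "('m::{t2_space,second_countable_topology}, 'e::euclidean_space) atlas"
    and A' :: "('n::{t2_space,second_countable_topology}, 'f::euclidean_space) atlas"
    and g :: "'m tensor02" and g' :: "'n tensor02" and \<pi> :: "'m \<Rightarrow> 'n" +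
  fixes nab nabs :: "'m connection" and P Ps :: "'m tensor11" and P' :: "'n tensor11"
  assumes para_kaehler: "para_kaehler_like_statistical_manifold A nab P g"
    and product_structure': "almost_product_structure A' P'"
    and intertwines: "\<forall>p. \<forall>u\<in>tangent_space A p. pushforward A' \<pi> (P p u) = P' (\<pi> p) (pushforward A' \<pi> u)"
    and conjugate: "conjugate_connection A g nab nabs"
    and skew_adjoint: "skew_adjoint_field A g P Ps"
begin

lemma P_tensor: "tensor_field11 A P"
  and P'_tensor: "tensor_field11 A' P'"
  and Ps_tensor: "tensor_field11 A Ps"
  using para_kaehler product_structure' skew_adjoint
  by (auto simp: para_kaehler_like_statistical_manifold_def almost_para_hermitian_like_manifold_def
      almost_product_structure_def skew_adjoint_field_def)

lemma P_tangent: "u \<in> T p \<Longrightarrow> P p u \<in> T p"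
  using P_tensor unfolding tensor_field11_def by blast

lemma Ps_tangent: "u \<in> T p \<Longrightarrow> Ps p u \<in> T p"
  using Ps_tensor unfolding tensor_field11_def by blast

lemma P_linear: "linear_on_subspace (T p) (P p)"
  and Ps_linear: "linear_on_subspace (T p) (Ps p)"
  and P'_linear: "linear_on_subspace (T' r) (P' r)"
  and P_field: "vector_field A X \<Longrightarrow> vector_field A (\<lambda>q. P q (X q))"
  using P_tensor Ps_tensor P'_tensor by (auto simp: tensor_field11_def)

lemma P_involution: "u \<in> T p \<Longrightarrow> P p (P p u) = u"
  using para_kaehler
  by (auto simp: para_kaehler_like_statistical_manifold_def almost_para_hermitian_like_manifold_def
      almost_product_structure_def)

lemma P_vertical: "u \<in> V p \<Longrightarrow> P p u \<in> V p"
  using linear_on_subspace_zero[OF P'_linear M'.subspace_tangent_space] intertwines P_tangent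
  by (auto simp: vertical_space_def)

lemma skew_adjoint_fields:
  "vector_field A E \<Longrightarrow> vector_field A F \<Longrightarrow> g p (P p (E p)) (F p) = - g p (E p) (Ps p (F p))"
  using skew_adjoint by (auto simp: skew_adjoint_field_def eq_neg_iff_add_eq_0)

lemma skew_adjoint_vectors:
  assumes "u \<in> T p" "w \<in> T p"
  shows "g p (P p u) w = - g p u (Ps p w)"
  using M.vector_field_extension[OF assms(1)] M.vector_field_extension[OF assms(2)]
    skew_adjoint_fields by metis

lemma nab_statistical: "statistical_structure A nab g"
  using para_kaehler by (simp add: para_kaehler_like_statistical_manifold_def)

lemma nab_affine: "affine_connection A nab" and nabs_affine: "affine_connection A nabs"
  using nab_statistical conjugate by (simp_all add: statistical_structure_def conjugate_connection_def)

lemma connection_field: "affine_connection A n \<Longrightarrow> vector_field A X \<Longrightarrow> vector_field A Y \<Longrightarrow> vector_field A (n X Y)"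
  unfolding affine_connection_def by blast

lemma connection_zero:
  assumes "affine_connection A n" "vector_field A X"
  shows "n X (\<lambda>p. 0) = (\<lambda>p. 0)"
proof -
  have "n X (\<lambda>p. 0 + 0) = (\<lambda>p. n X (\<lambda>p. 0) p + n X (\<lambda>p. 0) p)"
    using assms M.vector_field_zero unfolding affine_connection_def by blast
  then have "n X (\<lambda>p. 0) p = n X (\<lambda>p. 0) p + n X (\<lambda>p. 0) p" for p
    by (metis add.right_neutral)
  then show ?thesis by (simp add: fun_eq_iff)
qed

lemma nab_tangent: "vector_field A X \<Longrightarrow> vector_field A Y \<Longrightarrow> nab X Y p \<in> T p"
  and nabs_tangent: "vector_field A X \<Longrightarrow> vector_field A Y \<Longrightarrow> nabs X Y p \<in> T p"
  using connection_field[OF nab_affine] connection_field[OF nabs_affine] M.vector_field_tangent by blast+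

lemma torsion:
  "vector_field A X \<Longrightarrow> vector_field A Y \<Longrightarrow> nab X Y p - nab Y X p = lie_bracket X Y p"
  using nab_statistical by (auto simp: statistical_structure_def torsion_free_def)

lemma bracket_tangent: "vector_field A X \<Longrightarrow> vector_field A Y \<Longrightarrow> lie_bracket X Y p \<in> T p"
  using torsion[of X Y p] nab_tangent[of X Y p] nab_tangent[of Y X p]
    subspace_diff[OF M.subspace_tangent_space[of p]] by metis

lemma bracket_antisym: "lie_bracket X Y p = - lie_bracket Y X p"
  by (auto simp: lie_bracket_def fun_eq_iff)

lemma conjugate_product:
  "vector_field A E \<Longrightarrow> vector_field A F \<Longrightarrow> vector_field A G \<Longrightarrow>
   E p (\<lambda>q. g q (F q) (G q)) = g p (nab E F p) (G p) + g p (F p) (nabs E G p)"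
  using conjugate by (simp add: conjugate_connection_def)

lemma nab_P: "vector_field A X \<Longrightarrow> vector_field A Y \<Longrightarrow> nab X (\<lambda>q. P q (Y q)) p = P p (nab X Y p)"
  using para_kaehler by (simp add: para_kaehler_like_statistical_manifold_def cov_deriv11_def)

text \<open>The tensor \<open>(\<nabla>\<^sub>E g)(F, G) = g (F, \<nabla>\<^sup>*\<^sub>E G - \<nabla>\<^sub>E G)\<close> is totally symmetric, so exchanging \<open>E\<close>
  and \<open>G\<close> shows that \<open>\<nabla>\<^sup>*\<close> has the same torsion as \<open>\<nabla>\<close>, namely none.\<close>

lemma conjugate_torsion:
  assumes E: "vector_field A E" and F: "vector_field A F" and G: "vector_field A G"
  shows "g p (F p) (nabs E G p) - g p (F p) (nabs G E p) = g p (F p) (lie_bracket E G p)"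
proof -
  have sym: "cov_deriv_metric nab g E F G p = cov_deriv_metric nab g F E G p"
    if "vector_field A E" "vector_field A F" "vector_field A G" for E F G
    using nab_statistical that by (auto simp: statistical_structure_def)
  have swap: "cov_deriv_metric nab g E F G p = cov_deriv_metric nab g E G F p"
    if "vector_field A E" "vector_field A F" "vector_field A G" for E F G
  proof -
    have "(\<lambda>q. g q (F q) (G q)) = (\<lambda>q. g q (G q) (F q))"
      using that M.vector_field_tangent metric_sym by (auto simp: fun_eq_iff)
    then show ?thesis
      using metric_sym[OF nab_tangent[OF that(1,2), of p] M.vector_field_tangent[OF that(3), of p]]
        metric_sym[OF nab_tangent[OF that(1,3), of p] M.vector_field_tangent[OF that(2), of p]]
      by (simp add: cov_deriv_metric_def)
  qed
  have diff: "cov_deriv_metric nab g E F G p = g p (F p) (nabs E G p) - g p (F p) (nab E G p)"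
    if "vector_field A E" "vector_field A F" "vector_field A G" for E F G
    using conjugate_product[OF that] by (simp add: cov_deriv_metric_def)
  have "cov_deriv_metric nab g E F G p = cov_deriv_metric nab g G F E p"
    using sym[OF E F G] swap[OF F E G] sym[OF F G E] by simp
  then have "g p (F p) (nabs E G p) - g p (F p) (nabs G E p) = g p (F p) (nab E G p) - g p (F p) (nab G E p)"
    using diff[OF E F G] diff[OF G F E] by simp
  also have "\<dots> = g p (F p) (lie_bracket E G p)"
    using M.vector_field_tangent[OF F, of p] nab_tangent[OF E G, of p] nab_tangent[OF G E, of p]
    by (simp add: torsion[OF E G, symmetric] metric_simps)
  finally show ?thesis .
qed

lemma oneill_T_vertical:
  assumes "vertical_field A A' \<pi> U" "vertical_field A A' \<pi> W"
  shows "oneill_T A g A' \<pi> nab U W p = h p (nab U W p)"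
proof -
  have f: "vector_field A U" "(\<lambda>q. v q (U q)) = U" "(\<lambda>q. v q (W q)) = W" "(\<lambda>q. h q (W q)) = (\<lambda>q. 0)"
    using assms by (auto simp: vertical_field_def vproj_of_vertical hproj_def fun_eq_iff)
  show ?thesis
    unfolding oneill_T_def Let_def f(2-4) connection_zero[OF nab_affine f(1)]
    by (simp add: vproj_of_horizontal[OF subspace_0[OF subspace_horizontal]])
qed

lemma oneill_A_horizontal:
  assumes "affine_connection A n" "horizontal_field A g A' \<pi> X" "horizontal_field A g A' \<pi> Y"
  shows "oneill_A A g A' \<pi> n X Y p = v p (n X Y p)"
proof -
  have f: "vector_field A X" "(\<lambda>q. h q (X q)) = X" "(\<lambda>q. h q (Y q)) = Y" "(\<lambda>q. v q (Y q)) = (\<lambda>q. 0)"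
    using assms by (auto simp: horizontal_field_def vproj_of_horizontal hproj_def fun_eq_iff)
  show ?thesis
    unfolding oneill_A_def Let_def f(2-4) connection_zero[OF assms(1) f(1)]
    by (simp add: hproj_def vproj_of_vertical[OF subspace_0[OF subspace_vertical]])
qed

lemma bracket_vertical:
  assumes "vertical_field A A' \<pi> U" "vertical_field A A' \<pi> W"
  shows "lie_bracket U W p \<in> V p"
proof -
  have UW: "vector_field A U" "vector_field A W" "\<And>q. U q \<in> V q" "\<And>q. W q \<in> V q"
    using assms by (auto simp: vertical_field_def)
  have "lie_bracket U W p (\<lambda>q. f (\<pi> q)) = 0" if "smooth_fun A' f" for f
    using that UW(3,4) M.tangent_vector_const[OF vertical_tangent[OF UW(3)]]
      M.tangent_vector_const[OF vertical_tangent[OF UW(4)]]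
    by (simp add: lie_bracket_def vertical_iff)
  then show ?thesis using bracket_tangent[OF UW(1,2)] by (simp add: vertical_iff)
qed

lemma hproj_P:
  assumes "u \<in> T p" "w \<in> T p" "u - w \<in> V p"
  shows "h p (P p u) = h p (P p w)"
proof (rule hproj_eqI)
  show "P p u - P p w \<in> V p"
    using P_vertical[OF assms(3)] linear_on_subspace_diff[OF P_linear M.subspace_tangent_space assms(1,2)] by simp
qed (use assms P_tangent in auto)

text \<open>Symmetry modulo vertical vectors is used twice, before and after \<open>P\<close> is cancelled by
  \<open>P (P w) = w\<close>.\<close>

lemma oneill_T_P_invariant:
  assumes U: "vertical_field A A' \<pi> U" and W: "vertical_field A A' \<pi> W"
  shows "oneill_T A g A' \<pi> nab (\<lambda>q. P q (U q)) (\<lambda>q. P q (W q)) p = oneill_T A g A' \<pi> nab U W p"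
proof -
  have f: "vector_field A U" "vector_field A W" using U W by (auto simp: vertical_field_def)
  have PU: "vertical_field A A' \<pi> (\<lambda>q. P q (U q))" and PW: "vertical_field A A' \<pi> (\<lambda>q. P q (W q))"
    using U W P_field P_vertical by (auto simp: vertical_field_def)
  let ?PU = "\<lambda>q. P q (U q)"
  have "nab ?PU W p - nab W ?PU p \<in> V p"
    using torsion[OF P_field[OF f(1)] f(2)] bracket_vertical[OF PU W] by simp
  then have "h p (P p (nab ?PU W p)) = h p (P p (nab W ?PU p))"
    by (intro hproj_P nab_tangent P_field f)
  also have "\<dots> = h p (nab W U p)"
    using nab_P[OF f(2,1)] P_involution[OF nab_tangent[OF f(2,1)]] by simp
  also have "\<dots> = h p (nab U W p)"
    using torsion[OF f(2,1)] bracket_vertical[OF W U] by (intro hproj_eqI nab_tangent f) simp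
  finally show ?thesis
    using oneill_T_vertical[OF PU PW] oneill_T_vertical[OF U W] nab_P[OF P_field[OF f(1)] f(2)] by simp
qed

text \<open>The first equation combines the conjugate product rule for \<open>X g (Y, U)\<close>, which is zero, with that
  for \<open>U g (X, Y)\<close>, where the bracket terms of \<open>derivative_horizontal_horizontal\<close> appear in place
  of zero. One of them is absorbed because \<open>\<nabla>\<^sup>*\<close> is torsion-free, and in the second equation the other
  because \<open>\<nabla>\<close> is.\<close>

lemma vertical_component_exchange:
  assumes U: "vertical_to_first_order p U"
    and X: "horizontal_field A g A' \<pi> X" and Y: "horizontal_field A g A' \<pi> Y"
  shows "g p (nab X Y p) (U p) = g p (nab U Y p) (X p) - g p (lie_bracket U Y p) (X p)"
    and "g p (nab X Y p) (U p) = g p (nab Y U p) (X p)"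
    and "g p (nabs X Y p) (U p) = - g p (nab X U p) (Y p)"
proof -
  have Uf: "vector_field A U" using U by (simp add: vertical_to_first_order_def)
  have Xf: "vector_field A X" and Yf: "vector_field A Y" using X Y by (auto simp: horizontal_field_def)
  note t = M.vector_field_tangent[OF Uf, of p] M.vector_field_tangent[OF Xf, of p] M.vector_field_tangent[OF Yf, of p]
  have gUY: "(\<lambda>q. g q (Y q) (U q)) = (\<lambda>q. g q (U q) (Y q))" and gXY: "(\<lambda>q. g q (X q) (Y q)) = (\<lambda>q. g q (Y q) (X q))"
    using M.vector_field_tangent[OF Uf] M.vector_field_tangent[OF Xf] M.vector_field_tangent[OF Yf] metric_sym
    by (auto simp: fun_eq_iff)
  have 1: "g p (nab X Y p) (U p) + g p (Y p) (nabs X U p) = 0"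
    using conjugate_product[OF Xf Yf Uf, of p] derivative_vertical_horizontal[OF U t(2) Y] by (simp add: gUY)
  have 2: "g p (Y p) (nabs X U p) - g p (Y p) (nabs U X p) = - g p (Y p) (lie_bracket U X p)"
    using conjugate_torsion[OF Xf Yf Uf, of p] bracket_antisym[of X U p]
      linear_on_subspace_neg[OF metric_linear[OF t(3)] bracket_tangent[OF Uf Xf]] by simp
  have 3: "g p (nab U Y p) (X p) + g p (Y p) (nabs U X p)
      = g p (lie_bracket U X p) (Y p) + g p (X p) (lie_bracket U Y p)"
    using conjugate_product[OF Uf Yf Xf, of p] gXY
      derivative_horizontal_horizontal[OF U X Y bracket_tangent[OF Uf Xf] bracket_tangent[OF Uf Yf]] by simp
  show 4: "g p (nab X Y p) (U p) = g p (nab U Y p) (X p) - g p (lie_bracket U Y p) (X p)"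
    using 1 2 3 metric_sym[OF t(2) bracket_tangent[OF Uf Yf]] metric_sym[OF t(3) bracket_tangent[OF Uf Xf]] by simp
  show "g p (nab X Y p) (U p) = g p (nab Y U p) (X p)"
    unfolding 4 torsion[OF Uf Yf, symmetric]
    using t nab_tangent[OF Uf Yf, of p] nab_tangent[OF Yf Uf, of p] by (simp add: metric_simps)
  show "g p (nabs X Y p) (U p) = - g p (nab X U p) (Y p)"
    using conjugate_product[OF Xf Uf Yf, of p] derivative_vertical_horizontal[OF U t(2) Y]
      metric_sym[OF t(1) nabs_tangent[OF Xf Yf]] by simp
qed

text \<open>Both vectors project to the derivative along \<open>U\<close> of the components of \<open>d\<pi> Y\<close>, multiplied by the
  coefficients of \<open>P'\<close>: these coefficients are pulled back from the base, so their derivative along the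
  vertical vector \<open>U p\<close> is zero.\<close>

lemma P_lie_derivative_vertical:
  assumes U: "vertical_to_first_order p U" and Y: "vector_field A Y"
  shows "P p (lie_bracket U Y p) - lie_bracket U (\<lambda>q. P q (Y q)) p \<in> V p"
proof -
  have Uf: "vector_field A U" "U p \<in> V p" using U by (auto simp: vertical_to_first_order_def)
  note bY = bracket_tangent[OF Uf(1) Y, of p] and bPY = bracket_tangent[OF Uf(1) P_field[OF Y], of p]
  obtain N y W where fr: "local_frame A' N y W" "\<pi> p \<in> N" by (rule M'.local_frame_exists)
  have y: "smooth_fun A' (y b)" if "b \<in> Basis" for b using fr(1) that by (simp add: local_frame_def)
  have "P p (lie_bracket U Y p) (\<lambda>q. f (\<pi> q)) = lie_bracket U (\<lambda>q. P q (Y q)) p (\<lambda>q. f (\<pi> q))"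
    if f: "smooth_fun A' f" for f
  proof -
    have c: "U p (\<lambda>q. P' (\<pi> q) (W b (\<pi> q)) f) = 0" if "b \<in> Basis" for b
    proof -
      have "vector_field A' (\<lambda>r. P' r (W b r))"
        using P'_tensor frame_field[OF fr(1) that] by (simp add: tensor_field11_def)
      from M'.vector_field_smooth[OF this f] show ?thesis using Uf(2) unfolding vertical_iff by blast
    qed
    show ?thesis
      unfolding component_of_tensor_image[OF fr P'_tensor intertwines bY f]
        bracket_pushforward[OF U P_field[OF Y] f]
        derivative_of_tensor_component[OF fr vertical_tangent[OF Uf(2)] P_tensor P'_tensor intertwines Y f]
      by (intro sum.cong refl) (simp add: c y bracket_pushforward[OF U Y])
  qed
  then show ?thesis
    using P_tangent[OF bY] bPY subspace_diff[OF M.subspace_tangent_space] by (auto simp: vertical_iff)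
qed

lemma P_first_order:
  assumes U: "vertical_to_first_order p U"
  shows "vertical_to_first_order p (\<lambda>q. P q (U q))"
proof -
  obtain N y W where fr: "local_frame A' N y W" "\<pi> p \<in> N" by (rule M'.local_frame_exists)
  have y: "smooth_fun A' (y b)" if "b \<in> Basis" for b using fr(1) that by (simp add: local_frame_def)
  show ?thesis
    by (rule first_order_tensor[OF P_tensor P'_tensor intertwines _ fr])
       (use U y in \<open>auto simp: first_orderD vertical_to_first_order_def[of p U]\<close>)
qed

context
  assumes Ps_vertical: "\<And>p u. u \<in> V p \<Longrightarrow> Ps p u \<in> V p"
begin

lemma P_horizontal: "x \<in> H p \<Longrightarrow> P p x \<in> H p"
  using Ps_vertical
  by (auto simp: horizontal_space_def P_tangent skew_adjoint_vectors vertical_tangent)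

lemma Ps_horizontal:
  assumes "x \<in> H p" shows "Ps p x \<in> H p"
proof -
  have "g p (Ps p x) w = 0" if w: "w \<in> V p" for w
  proof -
    note t = horizontal_tangent[OF assms] vertical_tangent[OF w]
    have "g p (Ps p x) w = - g p (P p w) x"
      using skew_adjoint_vectors[OF t(2,1)] metric_sym[OF t(2) Ps_tangent[OF t(1)]] by simp
    also have "\<dots> = 0"
      using P_vertical[OF w] assms metric_sym[OF t(1) P_tangent[OF t(2)]] by (simp add: horizontal_space_def)
    finally show ?thesis .
  qed
  then show ?thesis using Ps_tangent[OF horizontal_tangent[OF assms]] by (simp add: horizontal_space_def)
qed

text \<open>The exchange lemma for \<open>P Y\<close> leads from the left-hand side to \<open>g (P (\<nabla>\<^sub>Y U), X)\<close>, and for \<open>P U\<close>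
  leads back. The bracket terms match because the Lie derivative of \<open>P\<close> along \<open>U\<close> is
  orthogonal to \<open>X\<close>.\<close>

lemma P_adjoint_exchange:
  assumes U: "vertical_to_first_order p U"
    and X: "horizontal_field A g A' \<pi> X" and Y: "horizontal_field A g A' \<pi> Y"
  shows "g p (P p (nab X Y p)) (U p) = g p (nab X Y p) (P p (U p))"
proof -
  have Uf: "vector_field A U" using U by (simp add: vertical_to_first_order_def)
  have Xf: "vector_field A X" and Yf: "vector_field A Y" and Xp: "X p \<in> H p"
    using X Y by (auto simp: horizontal_field_def)
  have PY: "horizontal_field A g A' \<pi> (\<lambda>q. P q (Y q))"
    using Y P_field P_horizontal by (auto simp: horizontal_field_def)
  let ?PY = "\<lambda>q. P q (Y q)" and ?PU = "\<lambda>q. P q (U q)"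
  note t = horizontal_tangent[OF Xp]
  note tP = P_tangent[OF nab_tangent[OF Uf Yf, of p]] P_tangent[OF nab_tangent[OF Yf Uf, of p]]
    P_tangent[OF bracket_tangent[OF Uf Yf, of p]] bracket_tangent[OF Uf P_field[OF Yf], of p]
  have "g p (X p) (P p (lie_bracket U Y p) - lie_bracket U ?PY p) = 0"
    using P_lie_derivative_vertical[OF U Yf] Xp by (simp add: horizontal_space_def)
  then have 1: "g p (lie_bracket U ?PY p) (X p) = g p (P p (lie_bracket U Y p)) (X p)"
    using t tP metric_sym[OF t] by (simp add: metric_simps)
  have 2: "P p (nab U Y p) - P p (lie_bracket U Y p) = P p (nab Y U p)"
    using linear_on_subspace_diff[OF P_linear M.subspace_tangent_space
        nab_tangent[OF Uf Yf] bracket_tangent[OF Uf Yf], of p] torsion[OF Uf Yf, of p] by (simp add: algebra_simps)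
  have "g p (P p (nab X Y p)) (U p) = g p (nab X ?PY p) (U p)"
    using nab_P[OF Xf Yf] by simp
  also have "\<dots> = g p (nab U ?PY p) (X p) - g p (lie_bracket U ?PY p) (X p)"
    by (rule vertical_component_exchange(1)[OF U X PY])
  also have "\<dots> = g p (P p (nab U Y p)) (X p) - g p (P p (lie_bracket U Y p)) (X p)"
    using nab_P[OF Uf Yf] 1 by simp
  also have "\<dots> = g p (P p (nab U Y p) - P p (lie_bracket U Y p)) (X p)"
    using t tP by (simp add: metric_simps)
  also have "\<dots> = g p (nab Y ?PU p) (X p)"
    unfolding 2 using nab_P[OF Yf Uf] by simp
  also have "\<dots> = g p (nab X Y p) (P p (U p))"
    by (rule vertical_component_exchange(2)[OF P_first_order[OF U] X Y, symmetric])
  finally show ?thesis .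
qed

lemma vertical_part_zeroI:
  assumes n: "n \<in> T p" and o: "\<And>u. u \<in> V p \<Longrightarrow> g p n u = 0"
  shows "v p n = 0"
  using n o by (intro vproj_of_horizontal) (simp add: horizontal_space_def)

text \<open>The identity for \<open>P\<close> and the definition of \<open>P\<^sup>*\<close> make the image of \<open>v (\<nabla>\<^sub>X Y)\<close> under \<open>P + P\<^sup>*\<close> orthogonal
  to all vertical vectors; it is itself vertical, hence zero.\<close>

lemma nab_horizontal:
  assumes rank: "rank_on (V p) (\<lambda>u. P p u + Ps p u) = dim (V p)"
    and X: "horizontal_field A g A' \<pi> X" and Y: "horizontal_field A g A' \<pi> Y"
  shows "v p (nab X Y p) = 0"
proof -
  have Xf: "vector_field A X" and Yf: "vector_field A Y" using X Y by (auto simp: horizontal_field_def)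
  let ?n = "nab X Y p"
  note n = nab_tangent[OF Xf Yf, of p]
  define w where "w = v p ?n"
  define z where "z = h p ?n"
  have nwz: "?n = w + z" by (simp add: w_def z_def hproj_def)
  have w: "w \<in> V p" "w \<in> T p" and z: "z \<in> H p" "z \<in> T p"
    using vproj_vertical[OF n] hproj_horizontal[OF n] vertical_tangent horizontal_tangent
    by (auto simp: w_def z_def)
  have sum0: "P p w + Ps p w \<in> V p"
    using P_vertical Ps_vertical w subspace_vertical by (simp add: subspace_add)
  have "g p (P p w + Ps p w) u = 0" if u: "u \<in> V p" for u
  proof -
    note uT = vertical_tangent[OF u]
    obtain U where U: "vertical_to_first_order p U" "U p = u" by (rule first_order_extension[OF u])
    have "g p (P p ?n) u + g p (Ps p ?n) u = 0"
      using P_adjoint_exchange[OF U(1) X Y] skew_adjoint_vectors[OF uT n] U(2)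
        metric_sym[OF uT Ps_tangent[OF n]] metric_sym[OF P_tangent[OF uT] n] by simp
    moreover have "P p ?n = P p w + P p z" "Ps p ?n = Ps p w + Ps p z"
      unfolding nwz using linear_on_subspace_add[OF P_linear w(2) z(2)] linear_on_subspace_add[OF Ps_linear w(2) z(2)] .
    moreover have "g p (P p z) u = 0" "g p (Ps p z) u = 0"
      using P_horizontal[OF z(1)] Ps_horizontal[OF z(1)] u by (auto simp: horizontal_space_def)
    ultimately show ?thesis
      using uT P_tangent[OF w(2)] P_tangent[OF z(2)] Ps_tangent[OF w(2)] Ps_tangent[OF z(2)]
      by (simp add: metric_simps)
  qed
  then have "P p w + Ps p w = 0" using sum0 nondegenerate_vertical[of p] by (simp add: nondegenerate_on_def)
  moreover have "linear_on_subspace (V p) (\<lambda>u. P p u + Ps p u)"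
    using P_linear[of p] Ps_linear[of p]
    by (simp add: linear_on_subspace_def scaleR_add_right vertical_tangent add_ac)
  moreover obtain B where "finite B" "T p \<subseteq> span B" by (rule M.tangent_space_finite_dim)
  moreover have "V p \<subseteq> T p" using vertical_tangent by blast
  ultimately have "w = 0"
    using full_rank_imp_injective[OF subspace_vertical _ _ _ rank w(1)] by blast
  then show ?thesis by (simp add: w_def)
qed

lemma nabs_horizontal:
  assumes rank: "rank_on (V p) (\<lambda>u. P p u + Ps p u) = dim (V p)"
    and X: "horizontal_field A g A' \<pi> X" and Y: "horizontal_field A g A' \<pi> Y"
  shows "v p (nabs X Y p) = 0"
proof -
  have Xf: "vector_field A X" and Yf: "vector_field A Y" using X Y by (auto simp: horizontal_field_def)
  have nYX: "nab Y X p \<in> H p"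
    using hproj_horizontal[OF nab_tangent[OF Yf Xf, of p]] nab_horizontal[OF rank Y X] by (simp add: hproj_def)
  show ?thesis
  proof (rule vertical_part_zeroI[OF nabs_tangent[OF Xf Yf]])
    fix u assume u: "u \<in> V p"
    obtain U where U: "vertical_to_first_order p U" "U p = u" by (rule first_order_extension[OF u])
    show "g p (nabs X Y p) u = 0"
      using vertical_component_exchange(3)[OF U(1) X Y] vertical_component_exchange(2)[OF U(1) Y X] nYX u U(2) by (simp add: horizontal_space_def)
  qed
qed

end

end

theorem theorem4p7:
  fixes A :: "('m::{t2_space,second_countable_topology}, 'e::euclidean_space) atlas"
    and A' :: "('n::{t2_space,second_countable_topology}, 'f::euclidean_space) atlas"
    and nab nabs :: "'m connection" and nab' :: "'n connection"
    and P Ps :: "'m tensor11" and P' :: "'n tensor11"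
    and g :: "'m tensor02" and g' :: "'n tensor02"
    and \<pi> :: "'m \<Rightarrow> 'n"
  assumes "para_kaehler_like_statistical_manifold A nab P g"
    and "almost_para_hermitian_like_manifold A' P' g'"
    and "statistical_structure A' nab' g'"
    and "para_kaehler_like_statistical_submersion A nab P g A' nab' P' g' \<pi>"
    and "conjugate_connection A g nab nabs"
    and "skew_adjoint_field A g P Ps"
  shows "(\<forall>U V. vertical_field A A' \<pi> U \<longrightarrow> vertical_field A A' \<pi> V \<longrightarrow>
            (\<forall>p. oneill_T A g A' \<pi> nab (\<lambda>q. P q (U q)) (\<lambda>q. P q (V q)) p = oneill_T A g A' \<pi> nab U V p))
       \<and> ((\<forall>p. Ps p ` vertical_space A A' \<pi> p \<subseteq> vertical_space A A' \<pi> p) \<longrightarrow>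
          (\<forall>p. rank_on (vertical_space A A' \<pi> p) (\<lambda>u. P p u + Ps p u) = dim (vertical_space A A' \<pi> p)) \<longrightarrow>
          (\<forall>X Y. horizontal_field A g A' \<pi> X \<longrightarrow> horizontal_field A g A' \<pi> Y \<longrightarrow>
             (\<forall>p. oneill_A A g A' \<pi> nab X Y p = 0 \<and> oneill_A A g A' \<pi> nabs X Y p = 0)))"
proof -
  interpret para_kaehler_submersion A A' g g' \<pi> nab nabs P Ps P'
    using assms
    by unfold_locales
       (auto simp: para_kaehler_like_statistical_submersion_def statistical_submersion_def
          almost_para_hermitian_like_statistical_submersion_def almost_para_hermitian_like_manifold_def)
  show ?thesis
  proof (intro conjI allI impI)
    fix U V p
    assume "vertical_field A A' \<pi> U" "vertical_field A A' \<pi> V"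
    then show "oneill_T A g A' \<pi> nab (\<lambda>q. P q (U q)) (\<lambda>q. P q (V q)) p = oneill_T A g A' \<pi> nab U V p"
      by (rule oneill_T_P_invariant)
  next
    fix X Y p
    assume Ps: "\<forall>p. Ps p ` vertical_space A A' \<pi> p \<subseteq> vertical_space A A' \<pi> p"
      and rank: "\<forall>p. rank_on (vertical_space A A' \<pi> p) (\<lambda>u. P p u + Ps p u) = dim (vertical_space A A' \<pi> p)"
      and X: "horizontal_field A g A' \<pi> X" and Y: "horizontal_field A g A' \<pi> Y"
    have Psv: "\<And>p u. u \<in> V p \<Longrightarrow> Ps p u \<in> V p" using Ps by blast
    show "oneill_A A g A' \<pi> nab X Y p = 0"
      unfolding oneill_A_horizontal[OF nab_affine X Y] by (rule nab_horizontal[OF Psv rank[rule_format] X Y])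
    show "oneill_A A g A' \<pi> nabs X Y p = 0"
      unfolding oneill_A_horizontal[OF nabs_affine X Y] by (rule nabs_horizontal[OF Psv rank[rule_format] X Y])
  qed
qed

end
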